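(* Let $k\ge 1$ be an integer and $n\ge 64k^6$. Let $\mathcal{G}'_{n,k}$ be the family of simple graphs of order $n$ with maximum degree $n-1$ that do not contain $k$ pairwise edge-disjoint cycles and that have the maximum number of edges among all such graphs. Let $\mathcal{G}''_{n,k}$ be the family of simple graphs of order $n$ that do not contain $k$ pairwise edge-disjoint cycles and that have the maximum spectral radius among all such graphs. Then $\mathcal{G}''_{n,k}\subseteq \mathcal{G}'_{n,k}$.
   Context: The spectral radius of a graph is the largest eigenvalue of its adjacency matrix. Graphs are not assumed planar here. *)

theory Defs
  imports "Jordan_Normal_Form.Char_Poly"
begin

definition simple_graph :: "nat \<Rightarrow> nat set set \<Rightarrow> bool" where
  "simple_graph n G \<longleftrightarrow> (\<forall>e\<in>G. card e = 2 \<and> e \<subseteq> {..<n})"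

definition degree :: "nat set set \<Rightarrow> nat \<Rightarrow> nat" where
  "degree G v = card {u. {u, v} \<in> G}"

definition max_degree :: "nat \<Rightarrow> nat set set \<Rightarrow> nat" where
  "max_degree n G = Max (degree G ` {..<n})"

definition cycle_edges :: "nat list \<Rightarrow> nat set set" where
  "cycle_edges c = {{c ! i, c ! ((i + 1) mod length c)} | i. i < length c}"

definition is_cycle :: "nat set set \<Rightarrow> nat list \<Rightarrow> bool" where
  "is_cycle G c \<longleftrightarrow> length c \<ge> 3 \<and> distinct c \<and> cycle_edges c \<subseteq> G"

definition has_k_edge_disjoint_cycles :: "nat \<Rightarrow> nat set set \<Rightarrow> bool" where
  "has_k_edge_disjoint_cycles k G \<longleftrightarrow>
     (\<exists>C :: nat \<Rightarrow> nat list. (\<forall>i<k. is_cycle G (C i)) \<and>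
        (\<forall>i<k. \<forall>j<k. i \<noteq> j \<longrightarrow> cycle_edges (C i) \<inter> cycle_edges (C j) = {}))"

definition adj_matrix :: "nat \<Rightarrow> nat set set \<Rightarrow> real mat" where
  "adj_matrix n G = mat n n (\<lambda>(i, j). if {i, j} \<in> G then 1 else 0)"

definition spectral_radius_graph :: "nat \<Rightarrow> nat set set \<Rightarrow> real" where
  "spectral_radius_graph n G = Max {\<mu>. eigenvalue (adj_matrix n G) \<mu>}"

definition G'_family :: "nat \<Rightarrow> nat \<Rightarrow> nat set set set" where
  "G'_family n k = {G. simple_graph n G \<and> max_degree n G = n - 1 \<and>
      \<not> has_k_edge_disjoint_cycles k G \<and>
      (\<forall>H. simple_graph n H \<and> max_degree n H = n - 1 \<and> \<not> has_k_edge_disjoint_cycles k H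
           \<longrightarrow> card H \<le> card G)}"

definition G''_family :: "nat \<Rightarrow> nat \<Rightarrow> nat set set set" where
  "G''_family n k = {G. simple_graph n G \<and> \<not> has_k_edge_disjoint_cycles k G \<and>
      (\<forall>H. simple_graph n H \<and> \<not> has_k_edge_disjoint_cycles k H
           \<longrightarrow> spectral_radius_graph n H \<le> spectral_radius_graph n G)}"

end

theory Submission
  imports Defs "HOL-Analysis.Function_Topology"
begin

text \<open>
  Removing fewer than \<open>k\<close> edge-disjoint cycles from a graph \<open>G\<close> in \<open>G''_family n k\<close> leaves a
  forest \<open>F\<close>, and the removed edges have maximum degree at most \<open>2 * (k - 1)\<close>. Comparison with the
  star gives \<open>\<rho>\<^sup>2 \<ge> n - 1\<close> for the spectral radius \<open>\<rho>\<close>. Let \<open>x\<close> be a Perron vector of \<open>G\<close>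
  with largest entry \<open>x u = 1\<close>. Counting walks of length two from \<open>u\<close> shows that \<open>u\<close> has almost full
  degree in \<open>F\<close>, and counting those from another vertex then shows that the other entries of \<open>x\<close> are below
  \<open>1 / (4 * k - 2)\<close>. If \<open>u\<close> were not adjacent to all vertices, some non-neighbour \<open>w\<close> would
  have degree at most \<open>4 * k - 2\<close>, so that \<open>\<rho> * x w < 1\<close>; making \<open>w\<close> a pendant neighbour
  of \<open>u\<close> would create no cycle and increase the spectral radius.

  When \<open>u\<close> is dominating and \<open>m\<close> edges avoid \<open>u\<close>, walks of length three give
  \<open>2 * m \<le> \<rho> * (\<rho>\<^sup>2 - (n - 1)) \<le> 2 * m * (1 + a / (\<rho> - a))\<close> with \<open>a = 2 * k - 1\<close>, and
  \<open>m \<le> a * (a - 1)\<close> because a matching of size \<open>k\<close> avoiding \<open>u\<close> spans \<open>k\<close> edge-disjoint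
  triangles with \<open>u\<close>. The lower bound holds for every graph with a dominating vertex, so a graph with
  more edges would have larger spectral radius.
\<close>
section \<open>Perron vectors of symmetric matrices\<close>

text \<open>Near 0 a nonzero linear term outweighs any quadratic one. This is how maximality of a
  quadratic form is turned into the eigenvalue equation.\<close>

lemma linear_le_quadratic_imp_zero:
  fixes b c :: real
  assumes "\<And>t. 2 * t * b \<le> c * t\<^sup>2"
  shows "b = 0"
proof (rule ccontr)
  assume b: "b \<noteq> 0"
  \<comment> \<open>The denominator is positive for every sign of \<open>c\<close>, and it makes
    \<open>(\<bar>c\<bar> + 1) * t\<^sup>2\<close> collapse to \<open>t * b\<close>.\<close>
  define t where "t = b / (\<bar>c\<bar> + 1)"
  have "2 * t * b \<le> c * t\<^sup>2" by (rule assms)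
  also have "\<dots> \<le> (\<bar>c\<bar> + 1) * t\<^sup>2" by (intro mult_right_mono) auto
  also have "\<dots> = t * b" by (simp add: t_def power2_eq_square)
  finally have "t * b \<le> 0" by (simp add: mult.assoc mult.commute)
  moreover have "t * b > 0"
    using b unfolding t_def by (simp add: zero_less_mult_iff zero_less_divide_iff) linarith
  ultimately show False by simp
qed

text \<open>Vectors are functions on all naturals, so that one coordinate can be changed by function
  update and compactness comes from the product topology.\<close>

definition quad_form :: "nat \<Rightarrow> (nat \<Rightarrow> nat \<Rightarrow> real) \<Rightarrow> (nat \<Rightarrow> real) \<Rightarrow> real" where
  "quad_form n a x = (\<Sum>i<n. \<Sum>j<n. a i j * x i * x j)"

text \<open>Changing a single coordinate is the only perturbation needed: it gives stationarity at a
  maximiser, and later the effect of rewiring one vertex.\<close>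

lemma quad_form_update:
  assumes sym: "\<And>i j. a i j = a j i" and i: "i < n"
  shows "quad_form n a (x(i := x i + t)) =
    quad_form n a x + 2 * t * (\<Sum>j<n. a i j * x j) + a i i * t\<^sup>2"
proof -
  let ?d = "\<lambda>j. if j = i then t else 0"
  have upd: "(x(i := x i + t)) j = x j + ?d j" for j by simp
  have *: "a k l * (x k + ?d k) * (x l + ?d l) =
      a k l * x k * x l + (if l = i then a k i * x k * t else 0) +
      (if k = i then t * (a i l * x l) else 0) + (if k = i then if l = i then a i i * t\<^sup>2 else 0 else 0)" for k l
    by (auto simp: algebra_simps power2_eq_square)
  have **: "(\<Sum>l<n. if k = i then f l else 0) = (if k = i then \<Sum>l<n. f l else 0)" for k and f :: "nat \<Rightarrow> real"
    by simp
  have "quad_form n a (x(i := x i + t)) =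
      quad_form n a x + (\<Sum>k<n. a k i * x k * t) + (\<Sum>l<n. t * (a i l * x l)) + a i i * t\<^sup>2"
    unfolding quad_form_def upd * sum.distrib ** using i by (simp add: sum.delta)
  also have "(\<Sum>k<n. a k i * x k * t) = (\<Sum>l<n. t * (a i l * x l))"
    by (intro sum.cong refl) (simp add: sym[of _ i])
  finally show ?thesis by (simp add: sum_distrib_left mult.assoc del: fun_upd_apply)
qed

lemma sum_square_update:
  fixes x :: "nat \<Rightarrow> real"
  assumes i: "i < n"
  shows "(\<Sum>j<n. ((x(i := x i + t)) j)\<^sup>2) = (\<Sum>j<n. (x j)\<^sup>2) + 2 * t * x i + t\<^sup>2"
proof -
  have "((x(i := x i + t)) j)\<^sup>2 = (x j)\<^sup>2 + (if j = i then 2 * t * x i + t\<^sup>2 else 0)" for j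
    by (auto simp: power2_eq_square algebra_simps)
  then show ?thesis using i by (simp add: sum.distrib)
qed

text \<open>By Tychonoff, the sphere being a closed subset of a product of compact sets. The
  coordinates from \<open>n\<close> on are pinned to 0 so that their factors are compact
  too.\<close>

lemma compact_sphere_fun:
  "compact {x :: nat \<Rightarrow> real. (\<forall>i\<ge>n. x i = 0) \<and> (\<Sum>i<n. (x i)\<^sup>2) = 1}" (is "compact ?S")
proof -
  let ?B = "\<lambda>i. if i < n then {-1..1} else {0::real}"
  have "compactin (product_topology (\<lambda>i. euclidean) UNIV) (PiE UNIV ?B)"
    by (simp add: compactin_PiE)
  then have "compact (PiE UNIV ?B)"
    by (simp add: euclidean_product_topology)
  moreover have "closed {x :: nat \<Rightarrow> real. (\<Sum>i<n. (x i)\<^sup>2) = 1}"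
    by (intro closed_Collect_eq continuous_intros continuous_on_product_coordinates)
  ultimately have "compact (PiE UNIV ?B \<inter> {x :: nat \<Rightarrow> real. (\<Sum>i<n. (x i)\<^sup>2) = 1})"
    by (rule compact_Int_closed)
  also have "PiE UNIV ?B \<inter> {x :: nat \<Rightarrow> real. (\<Sum>i<n. (x i)\<^sup>2) = 1} = ?S"
  proof (intro equalityI subsetI)
    fix x :: "nat \<Rightarrow> real" assume x: "x \<in> ?S"
    have "x i \<in> ?B i" for i
    proof (cases "i < n")
      case True
      then have "(x i)\<^sup>2 \<le> (\<Sum>i<n. (x i)\<^sup>2)" by (intro member_le_sum) auto
      with x have "\<bar>x i\<bar> \<le> 1" by (simp add: abs_square_le_1)
      then show ?thesis using True by (simp add: abs_le_iff)
    qed (use x in auto)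
    with x show "x \<in> PiE UNIV ?B \<inter> {x. (\<Sum>i<n. (x i)\<^sup>2) = 1}" by auto
  next
    fix x assume "x \<in> PiE UNIV ?B \<inter> {x :: nat \<Rightarrow> real. (\<Sum>i<n. (x i)\<^sup>2) = 1}"
    then show "x \<in> ?S" by (auto simp: PiE_def Pi_def) (metis linorder_not_less singletonD)
  qed
  finally show ?thesis .
qed

text \<open>Maximise the quadratic form over the unit sphere. Since all \<open>a i j\<close> are
  nonnegative, taking absolute values does not lower the form, so a nonnegative maximiser exists;
  stationarity makes it an eigenvector for the maximum.\<close>

lemma perron_symmetric:
  fixes a :: "nat \<Rightarrow> nat \<Rightarrow> real"
  assumes n: "0 < n" and sym: "\<And>i j. a i j = a j i" and nonneg: "\<And>i j. 0 \<le> a i j"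
  shows "\<exists>\<mu> x. (\<forall>i. 0 \<le> x i) \<and> (\<Sum>i<n. (x i)\<^sup>2) = 1 \<and>
    (\<forall>i<n. (\<Sum>j<n. a i j * x j) = \<mu> * x i) \<and>
    (\<forall>z. quad_form n a z \<le> \<mu> * (\<Sum>i<n. (z i)\<^sup>2))"
proof -
  let ?S = "{x :: nat \<Rightarrow> real. (\<forall>i\<ge>n. x i = 0) \<and> (\<Sum>i<n. (x i)\<^sup>2) = 1}"
  define S where "S = ?S"
  have "(\<lambda>i. if i = 0 then 1 else 0) \<in> S"
    using n by (auto simp: S_def if_distrib[of "\<lambda>x. x\<^sup>2"] cong: if_cong)
  then have "S \<noteq> {}" by blast
  moreover have "continuous_on S (quad_form n a)"
  proof -
    have "continuous_on S (\<lambda>x. x i)" for i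
      by (rule continuous_on_subset[OF continuous_on_product_coordinates]) simp
    then show ?thesis
      unfolding quad_form_def by (intro continuous_on_sum continuous_on_mult continuous_on_const)
  qed
  moreover have "compact S" unfolding S_def by (rule compact_sphere_fun)
  ultimately obtain x where "x \<in> S" and max: "\<And>z. z \<in> S \<Longrightarrow> quad_form n a z \<le> quad_form n a x"
    using continuous_attains_sup[of S "quad_form n a"] by blast
  then have x: "\<And>i. i \<ge> n \<Longrightarrow> x i = 0" "(\<Sum>i<n. (x i)\<^sup>2) = 1"
      "\<And>z. (\<And>i. i \<ge> n \<Longrightarrow> z i = 0) \<Longrightarrow> (\<Sum>i<n. (z i)\<^sup>2) = 1 \<Longrightarrow> quad_form n a z \<le> quad_form n a x"
    by (auto simp: S_def)
  define \<mu> where "\<mu> = quad_form n a x"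
  have bound: "quad_form n a z \<le> \<mu> * (\<Sum>i<n. (z i)\<^sup>2)" for z
  proof (cases "(\<Sum>i<n. (z i)\<^sup>2) = 0")
    case True
    then have "z i = 0" if "i < n" for i using that by (simp add: sum_nonneg_eq_0_iff)
    then show ?thesis unfolding True by (simp add: quad_form_def)
  next
    case False
    define s where "s = (\<Sum>i<n. (z i)\<^sup>2)"
    have s: "s > 0" using False unfolding s_def by (simp add: order_less_le sum_nonneg)
    define w where "w i = (if i < n then z i / sqrt s else 0)" for i
    have "(\<Sum>i<n. (w i)\<^sup>2) = (\<Sum>i<n. (z i)\<^sup>2 / s)"
      using s by (intro sum.cong refl) (simp add: w_def power_divide)
    also have "\<dots> = 1" using s by (simp add: s_def flip: sum_divide_distrib)
    finally have "quad_form n a w \<le> \<mu>" unfolding \<mu>_def by (intro x) (auto simp: w_def)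
    moreover have "quad_form n a w = quad_form n a z / s"
      unfolding quad_form_def sum_divide_distrib using s
      by (intro sum.cong refl) (simp add: w_def)
    ultimately show ?thesis using s by (simp add: s_def[symmetric] field_simps)
  qed
  define y where "y i = \<bar>x i\<bar>" for i
  have y1: "(\<Sum>i<n. (y i)\<^sup>2) = 1" using x by (simp add: y_def)
  have "a i j * x i * x j \<le> a i j * y i * y j" for i j
  proof -
    have "x i * x j \<le> y i * y j" by (simp add: y_def flip: abs_mult)
    then have "a i j * (x i * x j) \<le> a i j * (y i * y j)" by (rule mult_left_mono) (rule nonneg)
    then show ?thesis by (simp only: mult.assoc)
  qed
  then have "\<mu> \<le> quad_form n a y"
    unfolding \<mu>_def quad_form_def by (intro sum_mono)
  with bound[of y] y1 have y2: "quad_form n a y = \<mu>" by simp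
  have "(\<Sum>j<n. a i j * y j) = \<mu> * y i" if i: "i < n" for i
  proof -
    \<comment> \<open>The Rayleigh bound is an equality at \<open>y\<close>. Moving coordinate
      \<open>i\<close> by \<open>t\<close> therefore leaves a linear term in \<open>t\<close>
      bounded by a quadratic one.\<close>
    have "(\<Sum>j<n. a i j * y j) - \<mu> * y i = 0"
    proof (rule linear_le_quadratic_imp_zero)
      fix t
      show "2 * t * ((\<Sum>j<n. a i j * y j) - \<mu> * y i) \<le> (\<mu> - a i i) * t\<^sup>2"
        using bound[of "y(i := y i + t)"]
        unfolding quad_form_update[of a, OF sym i] sum_square_update[OF i] y1 y2
        by (simp add: algebra_simps)
    qed
    then show ?thesis by simp
  qed
  moreover have "\<forall>i. 0 \<le> y i" by (simp add: y_def)
  ultimately show ?thesis using y1 bound by blast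
qed

section \<open>Graphs and their spectral radius\<close>

definition nbrs :: "nat set set \<Rightarrow> nat \<Rightarrow> nat set" where
  "nbrs G v = {u. {u, v} \<in> G}"

definition adj :: "nat set set \<Rightarrow> nat \<Rightarrow> nat \<Rightarrow> real" where
  "adj G i j = of_bool ({i, j} \<in> G)"

lemma nbrs_sym: "u \<in> nbrs G v \<longleftrightarrow> v \<in> nbrs G u"
  by (simp add: nbrs_def insert_commute)

lemma nbrs_mono: "F \<subseteq> G \<Longrightarrow> nbrs F v \<subseteq> nbrs G v"
  by (auto simp: nbrs_def)

lemma simple_graph_subset: "simple_graph n G \<Longrightarrow> F \<subseteq> G \<Longrightarrow> simple_graph n F"
  by (auto simp: simple_graph_def)

lemma simple_graph_finite:
  assumes "simple_graph n G"
  shows "finite G"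
proof (rule finite_subset)
  show "G \<subseteq> Pow {..<n}" using assms by (auto simp: simple_graph_def)
qed simp

lemma not_self_nbr:
  assumes "simple_graph n G"
  shows "v \<notin> nbrs G v"
proof
  assume "v \<in> nbrs G v"
  then have "card {v} = 2" using assms unfolding simple_graph_def nbrs_def by fastforce
  then show False by simp
qed

lemma nbrs_lessThan: "simple_graph n G \<Longrightarrow> nbrs G v \<subseteq> {..<n}"
  by (auto simp: simple_graph_def nbrs_def)

lemma finite_nbrs: "simple_graph n G \<Longrightarrow> finite (nbrs G v)"
  by (rule finite_subset[OF nbrs_lessThan]) auto

lemma simple_graph_edgeE:
  assumes "simple_graph n G" "e \<in> G"
  obtains a b where "e = {a, b}" "a \<noteq> b" "a < n" "b < n"
proof -
  have "card e = 2" "e \<subseteq> {..<n}" using assms by (auto simp: simple_graph_def)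
  moreover from this obtain a b where "e = {a, b}" "a \<noteq> b" unfolding card_2_iff by blast
  ultimately show thesis using that[of a b] by simp
qed

lemma adj_sym: "adj G i j = adj G j i"
  by (simp add: adj_def insert_commute)

lemma sum_adj:
  assumes "simple_graph n G"
  shows "(\<Sum>j<n. adj G i j * x j) = sum x (nbrs G i)"
proof -
  have "(\<Sum>j<n. adj G i j * x j) = (\<Sum>j<n. if j \<in> nbrs G i then x j else 0)"
    by (intro sum.cong refl) (simp add: adj_def nbrs_def insert_commute)
  also have "\<dots> = sum x ({..<n} \<inter> nbrs G i)" by (rule sum.inter_restrict[symmetric]) simp
  finally show ?thesis using nbrs_lessThan[OF assms, of i] by (simp add: Int_absorb1)
qed

text \<open>Bridge from matrices and vectors to functions; all further spectral arguments are about
  functions.\<close>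

lemma eigenvalue_adj_matrix_iff:
  "eigenvalue (adj_matrix n G) \<mu> \<longleftrightarrow>
    (\<exists>x. (\<exists>i<n. x i \<noteq> 0) \<and> (\<forall>i<n. (\<Sum>j<n. adj G i j * x j) = \<mu> * x i))"
proof
  assume "eigenvalue (adj_matrix n G) \<mu>"
  then obtain v where v: "v \<in> carrier_vec n" "v \<noteq> 0\<^sub>v n"
      "adj_matrix n G *\<^sub>v v = \<mu> \<cdot>\<^sub>v v"
    by (auto simp: eigenvalue_def eigenvector_def adj_matrix_def)
  have "\<exists>i<n. vec_index v i \<noteq> 0"
  proof (rule ccontr)
    assume "\<not> ?thesis"
    then have "v = 0\<^sub>v n" using v(1) by (intro eq_vecI) auto
    with v(2) show False ..
  qed
  moreover have "(\<Sum>j<n. adj G i j * vec_index v j) = \<mu> * vec_index v i" if "i < n" for i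
  proof -
    have "vec_index (adj_matrix n G *\<^sub>v v) i = (\<Sum>j<n. adj G i j * vec_index v j)"
      using v(1) that
      by (simp add: adj_matrix_def adj_def of_bool_def scalar_prod_def atLeast0LessThan)
    then show ?thesis using v that by simp
  qed
  ultimately show "\<exists>x. (\<exists>i<n. x i \<noteq> 0) \<and> (\<forall>i<n. (\<Sum>j<n. adj G i j * x j) = \<mu> * x i)"
    by blast
next
  assume "\<exists>x. (\<exists>i<n. x i \<noteq> 0) \<and> (\<forall>i<n. (\<Sum>j<n. adj G i j * x j) = \<mu> * x i)"
  then obtain x where x: "\<exists>i<n. x i \<noteq> 0" "\<And>i. i < n \<Longrightarrow> (\<Sum>j<n. adj G i j * x j) = \<mu> * x i"
    by blast
  obtain i where "i < n" "x i \<noteq> 0" using x(1) by blast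
  then have "vec_index (Matrix.vec n x) i \<noteq> vec_index (0\<^sub>v n) i" by simp
  then have "Matrix.vec n x \<noteq> 0\<^sub>v n" by auto
  moreover have "adj_matrix n G *\<^sub>v Matrix.vec n x = \<mu> \<cdot>\<^sub>v Matrix.vec n x"
  proof (rule eq_vecI)
    fix i assume "i < dim_vec (\<mu> \<cdot>\<^sub>v Matrix.vec n x)"
    then have i: "i < n" by simp
    then have "vec_index (adj_matrix n G *\<^sub>v Matrix.vec n x) i = (\<Sum>j<n. adj G i j * x j)"
      by (simp add: adj_matrix_def adj_def of_bool_def scalar_prod_def atLeast0LessThan)
    then show "vec_index (adj_matrix n G *\<^sub>v Matrix.vec n x) i = vec_index (\<mu> \<cdot>\<^sub>v Matrix.vec n x) i"
      using x(2) i by simp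
  qed (simp add: adj_matrix_def)
  ultimately have "eigenvector (adj_matrix n G) (Matrix.vec n x) \<mu>"
    by (simp add: eigenvector_def adj_matrix_def)
  then show "eigenvalue (adj_matrix n G) \<mu>" by (auto simp: eigenvalue_def)
qed

text \<open>The eigenvalues are roots of the nonzero characteristic polynomial. Finiteness is what
  gives \<open>Max\<close> in \<open>spectral_radius_graph\<close> its meaning.\<close>

lemma finite_eigenvalues_adj: "finite {\<mu>. eigenvalue (adj_matrix n G) \<mu>}"
proof -
  have A: "adj_matrix n G \<in> carrier_mat n n" by (simp add: adj_matrix_def)
  have "char_poly (adj_matrix n G) \<noteq> 0" using degree_monic_char_poly[OF A] by auto
  then show ?thesis
    using poly_roots_finite by (simp add: eigenvalue_root_char_poly[OF A])
qed

text \<open>The maximum of the Rayleigh quotient is an eigenvalue, and evaluating the quotient at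
  any other eigenvector shows that no eigenvalue exceeds it; so it is the spectral radius.\<close>

lemma perron_graph:
  assumes n: "0 < n" and G: "simple_graph n G"
  obtains x u where "u < n" "x u = 1" "\<And>i. 0 \<le> x i" "\<And>i. i < n \<Longrightarrow> x i \<le> 1"
    "\<And>i. i < n \<Longrightarrow> sum x (nbrs G i) = spectral_radius_graph n G * x i"
    "\<And>z. quad_form n (adj G) z \<le> spectral_radius_graph n G * (\<Sum>i<n. (z i)\<^sup>2)"
proof -
  have nonneg: "0 \<le> adj G i j" for i j by (simp add: adj_def)
  obtain \<mu> x where "\<forall>i. 0 \<le> x i" and x2: "(\<Sum>i<n. (x i)\<^sup>2) = 1"
      and "\<forall>i<n. (\<Sum>j<n. adj G i j * x j) = \<mu> * x i"
      and "\<forall>z. quad_form n (adj G) z \<le> \<mu> * (\<Sum>i<n. (z i)\<^sup>2)"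
    using perron_symmetric[of n "adj G", OF n adj_sym nonneg] by blast
  then have x: "0 \<le> x i" "(\<Sum>i<n. (x i)\<^sup>2) = 1"
      "i < n \<Longrightarrow> (\<Sum>j<n. adj G i j * x j) = \<mu> * x i"
      "quad_form n (adj G) z \<le> \<mu> * (\<Sum>i<n. (z i)\<^sup>2)" for i z by simp_all
  have nz: "\<exists>i<n. x i \<noteq> 0"
  proof (rule ccontr)
    assume "\<not> (\<exists>i<n. x i \<noteq> 0)"
    then have "(\<Sum>i<n. (x i)\<^sup>2) = 0" by simp
    then show False using x2 by simp
  qed
  have rho: "spectral_radius_graph n G = \<mu>" unfolding spectral_radius_graph_def
  proof (rule Max_eqI[OF finite_eigenvalues_adj])
    show "\<mu> \<in> {\<mu>. eigenvalue (adj_matrix n G) \<mu>}"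
      using nz x(3) by (auto simp: eigenvalue_adj_matrix_iff)
  next
    fix \<nu> assume "\<nu> \<in> {\<mu>. eigenvalue (adj_matrix n G) \<mu>}"
    then obtain y where y: "\<exists>i<n. y i \<noteq> 0" "\<And>i. i < n \<Longrightarrow> (\<Sum>j<n. adj G i j * y j) = \<nu> * y i"
      by (auto simp: eigenvalue_adj_matrix_iff)
    have "quad_form n (adj G) y = (\<Sum>i<n. y i * (\<Sum>j<n. adj G i j * y j))"
      by (simp add: quad_form_def sum_distrib_left mult_ac)
    also have "\<dots> = (\<Sum>i<n. \<nu> * (y i)\<^sup>2)"
      by (intro sum.cong refl) (simp add: y(2) power2_eq_square)
    finally have "\<nu> * (\<Sum>i<n. (y i)\<^sup>2) \<le> \<mu> * (\<Sum>i<n. (y i)\<^sup>2)"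
      using x(4)[of y] by (simp add: sum_distrib_left)
    moreover obtain i where "i < n" "y i \<noteq> 0" using y(1) by blast
    then have "(\<Sum>i<n. (y i)\<^sup>2) > 0" by (intro sum_pos2[of _ i]) auto
    ultimately show "\<nu> \<le> \<mu>" by simp
  qed
  \<comment> \<open>Dividing by the largest entry puts the maximum 1 at \<open>u\<close>; the
    eigenvalue equations are homogeneous and survive.\<close>
  define s where "s = Max (x ` {..<n})"
  have "s \<in> x ` {..<n}" unfolding s_def using n by (intro Max_in) auto
  then obtain u where u: "u < n" "x u = s" by auto
  have le: "x i \<le> s" if "i < n" for i using that by (simp add: s_def)
  obtain i where "i < n" "x i \<noteq> 0" using nz by blast
  with x(1)[of i] le[of i] have "s > 0" by linarith
  moreover have "sum (\<lambda>i. x i / s) (nbrs G i) = \<mu> * (x i / s)" if "i < n" for i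
    using x(3)[OF that] by (simp add: sum_adj[OF G] flip: sum_divide_distrib)
  ultimately show thesis
    using u le x(1,4) rho by (intro that[of u "\<lambda>i. x i / s"]) auto
qed

lemma quad_form_le_spectral_radius:
  assumes "0 < n" and "simple_graph n G"
  shows "quad_form n (adj G) z \<le> spectral_radius_graph n G * (\<Sum>i<n. (z i)\<^sup>2)"
  by (rule perron_graph[OF assms]) simp

section \<open>Cycles and forests\<close>

lemma mem_cycle_edges_iff:
  "e \<in> cycle_edges c \<longleftrightarrow> (\<exists>i<length c. e = {c ! i, c ! (Suc i mod length c)})"
  by (auto simp: cycle_edges_def)

lemma cyclic_pred:
  assumes "i < (l::nat)"
  obtains p where "p < l" "Suc p mod l = i"
proof (cases i)
  case 0
  then show thesis using that[of "l - 1"] assms by simp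
next
  case (Suc j)
  then show thesis using that[of j] assms by simp
qed

lemma cyclic_pred_unique:
  assumes "i < (l::nat)" "j < l" "Suc i mod l = Suc j mod l"
  shows "i = j"
proof (cases "Suc i = l \<or> Suc j = l")
  case True
  then show ?thesis
  proof
    assume "Suc i = l"
    then show ?thesis using assms by (cases "Suc j = l") auto
  next
    assume "Suc j = l"
    then show ?thesis using assms by (cases "Suc i = l") auto
  qed
next
  case False
  then have "Suc i < l" "Suc j < l" using assms by auto
  then show ?thesis using assms(3) by simp
qed

lemma cycle_edge_subset:
  assumes "e \<in> cycle_edges c"
  shows "e \<subseteq> set c"
proof -
  obtain i where i: "i < length c" "e = {c ! i, c ! (Suc i mod length c)}"
    using assms by (auto simp: mem_cycle_edges_iff)
  moreover have "Suc i mod length c < length c" using i(1) by (intro mod_less_divisor) linarith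
  ultimately show ?thesis by simp
qed

text \<open>The predecessor and the successor on the cycle serve as the two neighbours.\<close>

lemma cycle_vertex_two_nbrs:
  assumes c: "is_cycle G c" and v: "v \<in> set c"
  obtains a b where "a \<noteq> b" "a \<in> nbrs G v" "b \<in> nbrs G v"
proof -
  let ?l = "length c"
  obtain i where i: "i < ?l" "v = c ! i" using v by (metis in_set_conv_nth)
  obtain p where p: "p < ?l" "Suc p mod ?l = i" using cyclic_pred i(1) by blast
  define q where "q = Suc i mod ?l"
  have l: "?l \<ge> 3" "distinct c" "cycle_edges c \<subseteq> G" using c by (auto simp: is_cycle_def)
  have q: "q < ?l" unfolding q_def using l(1) by (intro mod_less_divisor) linarith
  \<comment> \<open>If they coincided, two steps forward would return to the start, which length at
    least 3 forbids.\<close>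
  have "p \<noteq> q"
  proof
    assume "p = q"
    then have "Suc (Suc i mod ?l) mod ?l = i" using p by (simp add: q_def)
    then have "(i + 2) mod ?l = i" by (simp add: mod_Suc_eq)
    then show False using i(1) l(1)
      by (cases "i + 2 < ?l") (auto simp: mod_if not_less split: if_splits)
  qed
  then have "c ! p \<noteq> c ! q" using l p q by (simp add: nth_eq_iff_index_eq)
  moreover have "{c ! p, v} \<in> cycle_edges c" using p i by (auto simp: mem_cycle_edges_iff)
  moreover have "{c ! q, v} \<in> cycle_edges c"
    using i by (auto simp: mem_cycle_edges_iff q_def insert_commute)
  ultimately show thesis using that l(3) by (auto simp: nbrs_def)
qed

text \<open>As \<open>c\<close> is distinct, \<open>v\<close> occupies one position, so only its
  predecessor and successor can be joined to it.\<close>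

lemma card_nbrs_cycle_le_2:
  assumes "distinct c"
  shows "card (nbrs (cycle_edges c) v) \<le> 2"
proof (cases "v \<in> set c")
  case True
  let ?l = "length c"
  obtain i where i: "i < ?l" "v = c ! i" using True by (metis in_set_conv_nth)
  obtain p where p: "p < ?l" "Suc p mod ?l = i" using cyclic_pred i(1) by blast
  have "nbrs (cycle_edges c) v \<subseteq> {c ! p, c ! (Suc i mod ?l)}"
  proof
    fix u assume "u \<in> nbrs (cycle_edges c) v"
    then obtain j where j: "j < ?l" "{u, v} = {c ! j, c ! (Suc j mod ?l)}"
      by (auto simp: nbrs_def mem_cycle_edges_iff)
    have sj: "Suc j mod ?l < ?l" using j(1) by (intro mod_less_divisor) linarith
    from j(2) consider "v = c ! j" "u = c ! (Suc j mod ?l)" | "v = c ! (Suc j mod ?l)" "u = c ! j"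
      by (auto simp: doubleton_eq_iff)
    then show "u \<in> {c ! p, c ! (Suc i mod ?l)}"
    proof cases
      case 1
      then have "i = j" using i j(1) assms by (simp add: nth_eq_iff_index_eq)
      then show ?thesis using 1 by simp
    next
      case 2
      then have "i = Suc j mod ?l" using i sj assms by (simp add: nth_eq_iff_index_eq)
      then have "p = j" using p j cyclic_pred_unique by metis
      then show ?thesis using 2 by simp
    qed
  qed
  then have "card (nbrs (cycle_edges c) v) \<le> card {c ! p, c ! (Suc i mod ?l)}"
    by (rule card_mono[rotated]) simp
  also have "\<dots> \<le> 2" by (simp add: card_insert_if)
  finally show ?thesis .
next
  case False
  then have "nbrs (cycle_edges c) v = {}" using cycle_edge_subset by (fastforce simp: nbrs_def)
  then show ?thesis by simp
qed

text \<open>Take a longest path in \<open>W\<close>, which exists because \<open>W\<close> is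
  finite. All neighbours of its first vertex inside \<open>W\<close> lie on the path, since any
  other one could be prepended.\<close>

lemma min_degree_two_imp_cycle:
  assumes W: "finite W" "W \<noteq> {}"
    and deg: "\<And>w. w \<in> W \<Longrightarrow> 2 \<le> card (nbrs F w \<inter> W)"
    and loop: "\<And>w. w \<notin> nbrs F w"
  shows "\<exists>c. is_cycle F c"
proof -
  define path where "path p \<longleftrightarrow> p \<noteq> [] \<and> distinct p \<and> set p \<subseteq> W \<and>
    (\<forall>i. Suc i < length p \<longrightarrow> {p ! i, p ! Suc i} \<in> F)" for p
  obtain w where "w \<in> W" using W by blast
  then have path_w: "path [w]" by (simp add: path_def)
  have "length p \<le> card W" if "path p" for p
  proof -
    have "card (set p) \<le> card W" using that W(1) by (intro card_mono) (simp_all add: path_def)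
    then show ?thesis using that by (simp add: path_def distinct_card)
  qed
  then have "\<exists>p. path p \<and> (\<forall>q. path q \<longrightarrow> length q \<le> length p)"
    using path_w by (intro ex_has_greatest_nat[of path "[w]" length "Suc (card W)"]) (auto simp: less_Suc_eq_le)
  then obtain p where p: "path p" and max: "\<And>q. path q \<Longrightarrow> length q \<le> length p" by blast
  define v where "v = p ! 0"
  have p': "p \<noteq> []" "distinct p" "set p \<subseteq> W" "\<And>i. Suc i < length p \<Longrightarrow> {p ! i, p ! Suc i} \<in> F"
    using p by (simp_all add: path_def)
  then have v: "v \<in> W" unfolding v_def by (metis length_greater_0_conv nth_mem subsetD)
  have inp: "z \<in> set p" if z: "z \<in> nbrs F v \<inter> W" for z
  proof (rule ccontr)
    assume "z \<notin> set p"
    moreover have "{(z # p) ! i, (z # p) ! Suc i} \<in> F" if "Suc i < length (z # p)" for i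
      using that z p'(4) by (cases i) (auto simp: nbrs_def v_def)
    ultimately have "path (z # p)" using p'(2,3) z unfolding path_def by auto
    from max[OF this] show False by simp
  qed
  \<comment> \<open>Having two neighbours in \<open>W\<close>, \<open>v\<close> has one different
    from its successor on the path. Its position \<open>j\<close> is at least 2, so the initial
    segment up to it closes to a cycle of length at least 3.\<close>
  have "\<not> nbrs F v \<inter> W \<subseteq> {p ! 1}"
  proof
    assume "nbrs F v \<inter> W \<subseteq> {p ! 1}"
    then have "card (nbrs F v \<inter> W) \<le> card {p ! 1}" by (rule card_mono[rotated]) simp
    then show False using deg[OF v] by simp
  qed
  then obtain z where z: "z \<in> nbrs F v \<inter> W" "z \<noteq> p ! 1" by blast
  with inp have "z \<in> set p" by blast
  then obtain j where j: "j < length p" "z = p ! j" unfolding in_set_conv_nth by blast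
  have "j \<noteq> 0"
  proof
    assume "j = 0"
    then show False using z j loop[of v] by (simp add: v_def)
  qed
  moreover have "j \<noteq> 1" using z j by auto
  ultimately have j2: "2 \<le> j" by simp
  let ?c = "take (Suc j) p"
  have "cycle_edges ?c \<subseteq> F"
  proof
    fix e assume "e \<in> cycle_edges ?c"
    then obtain i where i: "i < Suc j" "e = {p ! i, ?c ! (Suc i mod Suc j)}"
      using j by (auto simp: mem_cycle_edges_iff)
    show "e \<in> F"
    proof (cases "i = j")
      case True
      then show ?thesis using i z j by (simp add: nbrs_def v_def)
    next
      case False
      then show ?thesis using i j p'(4)[of i] by simp
    qed
  qed
  then have "is_cycle F ?c" using j j2 p' by (simp add: is_cycle_def)
  then show ?thesis ..
qed

lemma acyclic_low_degree_vertex: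
  assumes F: "simple_graph n F" "\<nexists>c. is_cycle F c" and W: "finite W" "W \<noteq> {}"
  obtains w where "w \<in> W" "card (nbrs F w \<inter> W) \<le> 1"
proof -
  have "\<exists>w\<in>W. card (nbrs F w \<inter> W) < 2"
    using min_degree_two_imp_cycle[OF W, of F] F not_self_nbr[OF F(1)] by force
  then show thesis using that by fastforce
qed

text \<open>Delete a vertex with at most one neighbour in \<open>W\<close>: this loses at most one
  edge, and induction on the size of \<open>W\<close> applies.\<close>

lemma acyclic_card_edges:
  assumes F: "simple_graph n F" "\<nexists>c. is_cycle F c" and W: "finite W" "W \<noteq> {}"
  shows "card {e \<in> F. e \<subseteq> W} < card W"
  using W
proof (induction "card W" arbitrary: W rule: less_induct)
  case less
  obtain w where w: "w \<in> W" "card (nbrs F w \<inter> W) \<le> 1"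
    using acyclic_low_degree_vertex[OF F less.prems] .
  have finF: "finite F" using F simple_graph_finite by blast
  show ?case
  proof (cases "W = {w}")
    case True
    have "e \<notin> {e \<in> F. e \<subseteq> W}" for e
    proof
      assume e: "e \<in> {e \<in> F. e \<subseteq> W}"
      then have "card e = 2" using F(1) by (simp add: simple_graph_def)
      moreover have "card e \<le> card {w}" using e True by (intro card_mono) auto
      ultimately show False by simp
    qed
    then have "{e \<in> F. e \<subseteq> W} = {}" by blast
    then have "card {e \<in> F. e \<subseteq> W} = 0" by (simp only: card.empty)
    then show ?thesis using True by simp
  next
    case False
    let ?W = "W - {w}"
    have ne: "?W \<noteq> {}" "finite ?W" "card ?W < card W" "Suc (card ?W) = card W"
      using False w(1) less.prems card_Suc_Diff1[OF less.prems(1) w(1)] by (auto simp: card_Diff1_less)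
    have "{e \<in> F. e \<subseteq> W} \<subseteq> {e \<in> F. e \<subseteq> ?W} \<union> (\<lambda>z. {z, w}) ` (nbrs F w \<inter> W)"
    proof
      fix e assume e: "e \<in> {e \<in> F. e \<subseteq> W}"
      then have "e \<in> F" by simp
      then obtain a b where ab: "e = {a, b}" using simple_graph_edgeE[OF F(1)] by metis
      show "e \<in> {e \<in> F. e \<subseteq> ?W} \<union> (\<lambda>z. {z, w}) ` (nbrs F w \<inter> W)"
        using e ab by (auto simp: nbrs_def insert_commute)
    qed
    then have "card {e \<in> F. e \<subseteq> W} \<le> card ({e \<in> F. e \<subseteq> ?W} \<union> (\<lambda>z. {z, w}) ` (nbrs F w \<inter> W))"
      using finF less.prems by (intro card_mono) auto
    also have "\<dots> \<le> card {e \<in> F. e \<subseteq> ?W} + card ((\<lambda>z. {z, w}) ` (nbrs F w \<inter> W))"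
      by (rule card_Un_le)
    also have "card ((\<lambda>z. {z, w}) ` (nbrs F w \<inter> W)) \<le> 1"
      using w(2) less.prems(1) by (intro order_trans[OF card_image_le]) auto
    finally show ?thesis using less.hyps[OF ne(3) ne(2) ne(1)] ne(4) by linarith
  qed
qed

section \<open>Splitting off edge-disjoint cycles\<close>

lemma has_k_edge_disjoint_cyclesI:
  assumes "\<And>i. i < k \<Longrightarrow> is_cycle G (C i)"
    and "\<And>i j. i < k \<Longrightarrow> j < k \<Longrightarrow> i \<noteq> j \<Longrightarrow> cycle_edges (C i) \<inter> cycle_edges (C j) = {}"
  shows "has_k_edge_disjoint_cycles k G"
  unfolding has_k_edge_disjoint_cycles_def by (intro exI[of _ C] conjI allI impI assms)

text \<open>Remove cycles one at a time until none is left. Each removed cycle adds at most 2 to the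
  degree of a vertex in \<open>G - F\<close>, and at most \<open>k\<close> cycles can be removed.
  With \<open>Suc k\<close> in the hypothesis the base case is an acyclic graph.\<close>

lemma cycle_decomposition:
  assumes "\<not> has_k_edge_disjoint_cycles (Suc k) G"
  shows "\<exists>F\<subseteq>G. (\<nexists>c. is_cycle F c) \<and> (\<forall>v. card (nbrs (G - F) v) \<le> 2 * k)"
  using assms
proof (induction k arbitrary: G)
  case 0
  then have "\<nexists>c. is_cycle G c" by (auto simp: has_k_edge_disjoint_cycles_def)
  then show ?case by (intro exI[of _ G]) (auto simp: nbrs_def)
next
  case (Suc k)
  show ?case
  proof (cases "\<exists>c. is_cycle G c")
    case False
    then show ?thesis by (intro exI[of _ G]) (auto simp: nbrs_def)
  next
    case True
    then obtain c where c: "is_cycle G c" ..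
    let ?G = "G - cycle_edges c"
    have "\<not> has_k_edge_disjoint_cycles (Suc k) ?G"
    proof
      assume "has_k_edge_disjoint_cycles (Suc k) ?G"
      then obtain C where C0: "\<forall>i<Suc k. is_cycle ?G (C i)"
        "\<forall>i<Suc k. \<forall>j<Suc k. i \<noteq> j \<longrightarrow> cycle_edges (C i) \<inter> cycle_edges (C j) = {}"
        unfolding has_k_edge_disjoint_cycles_def by blast
      have C: "is_cycle ?G (C i)" if "i < Suc k" for i using C0(1) that by blast
      have C_disj: "cycle_edges (C i) \<inter> cycle_edges (C j) = {}"
        if "i < Suc k" "j < Suc k" "i \<noteq> j" for i j using C0(2) that by blast
      define D where "D = C(Suc k := c)"
      have D: "is_cycle G (D i)" if "i < Suc (Suc k)" for i
        using C[of i] c that by (cases "i = Suc k") (auto simp: D_def is_cycle_def)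
      have disj: "cycle_edges c \<inter> cycle_edges (C i) = {}" if "i < Suc k" for i
        using C[OF that] by (auto simp: is_cycle_def)
      have "cycle_edges (D i) \<inter> cycle_edges (D j) = {}"
        if ij: "i < Suc (Suc k)" "j < Suc (Suc k)" "i \<noteq> j" for i j
      proof -
        consider "i = Suc k" "j < Suc k" | "j = Suc k" "i < Suc k" | "i < Suc k" "j < Suc k"
          using ij by linarith
        then show ?thesis
        proof cases
          case 1 then show ?thesis using disj[of j] by (simp add: D_def)
        next
          case 2 then show ?thesis using disj[of i] by (simp add: D_def Int_commute)
        next
          case 3 then show ?thesis using C_disj[of i j] ij by (simp add: D_def)
        qed
      qed
      with D have "has_k_edge_disjoint_cycles (Suc (Suc k)) G"
        by (rule has_k_edge_disjoint_cyclesI)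
      with Suc.prems show False ..
    qed
    from Suc.IH[OF this] obtain F where F: "F \<subseteq> ?G" "\<nexists>c. is_cycle F c"
      "\<forall>v. card (nbrs (?G - F) v) \<le> 2 * k" by blast
    have "card (nbrs (G - F) v) \<le> 2 * Suc k" for v
    proof -
      have "nbrs (G - F) v = nbrs (?G - F) v \<union> nbrs (cycle_edges c) v"
        using c F(1) by (auto simp: nbrs_def is_cycle_def)
      then have "card (nbrs (G - F) v) \<le> card (nbrs (?G - F) v) + card (nbrs (cycle_edges c) v)"
        by (simp add: card_Un_le)
      also have "\<dots> \<le> 2 * k + 2"
        using c F(3) card_nbrs_cycle_le_2[of c v] by (intro add_mono) (auto simp: is_cycle_def)
      finally show ?thesis by simp
    qed
    then show ?thesis using F(1,2) by blast
  qed
qed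

section \<open>Short cycles, matchings and double counting\<close>

lemma cycle_edges_eq_image:
  "cycle_edges c = (\<lambda>i. {c ! i, c ! (Suc i mod length c)}) ` {..<length c}"
  by (auto simp: cycle_edges_def)

lemma cycle_edges_triangle: "cycle_edges [a, b, c] = {{a, b}, {b, c}, {c, a}}"
  by (simp add: cycle_edges_eq_image lessThan_Suc insert_commute)

lemma cycle_edges_square: "cycle_edges [a, b, c, d] = {{a, b}, {b, c}, {c, d}, {d, a}}"
  by (simp add: cycle_edges_eq_image lessThan_Suc insert_commute)

text \<open>Pairing up \<open>2 * k\<close> common neighbours of two vertices yields \<open>k\<close> edge-disjoint 4-cycles.\<close>

lemma codegree_less:
  assumes G: "simple_graph n G" "\<not> has_k_edge_disjoint_cycles k G" and uw: "u \<noteq> w"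
  shows "card (nbrs G u \<inter> nbrs G w) < 2 * k"
proof (rule ccontr)
  let ?A = "nbrs G u \<inter> nbrs G w"
  assume "\<not> card ?A < 2 * k"
  then have card: "2 * k \<le> card ?A" by simp
  have "finite ?A" using finite_nbrs[OF G(1)] by simp
  then obtain f where f: "bij_betw f {0..<card ?A} ?A"
    using ex_bij_betw_nat_finite by blast
  have f_in: "f a \<in> ?A" if "a < 2 * k" for a
    using f card that by (auto simp: bij_betw_def)
  have f_inj: "f a = f b \<longleftrightarrow> a = b" if "a < 2 * k" "b < 2 * k" for a b
    using f card that by (auto simp: bij_betw_def inj_on_def)
  have f_ne: "f a \<noteq> u" "f a \<noteq> w" if "a < 2 * k" for a
    using f_in[OF that] not_self_nbr[OF G(1)] by auto
  have f_edge: "{u, f a} \<in> G" "{f a, u} \<in> G" "{w, f a} \<in> G" "{f a, w} \<in> G" if "a < 2 * k" for a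
    using f_in[OF that] by (auto simp: nbrs_def insert_commute)
  define C where "C i = [u, f (2 * i), w, f (2 * i + 1)]" for i
  have cyc: "is_cycle G (C i)" if "i < k" for i
    using that uw f_ne[of "2 * i"] f_ne[of "2 * i + 1"] f_inj[of "2 * i" "2 * i + 1"]
      f_edge[of "2 * i"] f_edge[of "2 * i + 1"]
    by (simp add: is_cycle_def C_def cycle_edges_square)
  have C_edge: "\<exists>p\<in>{u, w}. \<exists>a\<in>{2 * i, 2 * i + 1}. e = {p, f a}"
    if "e \<in> cycle_edges (C i)" for e i
    using that by (auto simp: C_def cycle_edges_square insert_commute)
  have "cycle_edges (C i) \<inter> cycle_edges (C j) = {}" if ij: "i < k" "j < k" "i \<noteq> j" for i j
  proof (rule ccontr)
    assume "cycle_edges (C i) \<inter> cycle_edges (C j) \<noteq> {}"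
    then obtain e where e: "e \<in> cycle_edges (C i)" "e \<in> cycle_edges (C j)" by blast
    obtain p a where pa: "p \<in> {u, w}" "a = 2 * i \<or> a = 2 * i + 1" "e = {p, f a}"
      using C_edge[OF e(1)] by blast
    obtain q b where qb: "q \<in> {u, w}" "b = 2 * j \<or> b = 2 * j + 1" "e = {q, f b}"
      using C_edge[OF e(2)] by blast
    have ab: "a < 2 * k" "b < 2 * k" using pa(2) qb(2) ij by auto
    \<comment> \<open>A common edge determines its endpoint outside \<open>{u, w}\<close>, so both
      cycles would use the same index of \<open>f\<close>; but the index pairs of different cycles
      are disjoint.\<close>
    have "f a \<noteq> q" using f_ne[OF ab(1)] qb(1) by auto
    moreover have "f a \<in> {q, f b}" using pa(3) qb(3) by (metis insertI1 insert_commute)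
    ultimately have "a = b" using f_inj[OF ab] by auto
    then show False using pa(2) qb(2) ij(3) by presburger
  qed
  with cyc have "has_k_edge_disjoint_cycles k G" by (rule has_k_edge_disjoint_cyclesI)
  with G(2) show False ..
qed

text \<open>Makes results on \<open>k\<close> edge-disjoint cycles, notably
  \<open>codegree_less\<close>, applicable to forests with \<open>k = 1\<close>.\<close>

lemma acyclic_iff_no_1_cycle: "(\<nexists>c. is_cycle F c) \<longleftrightarrow> \<not> has_k_edge_disjoint_cycles 1 F"
  by (auto simp: has_k_edge_disjoint_cycles_def)

lemma acyclic_no_triangle:
  assumes "simple_graph n F" "\<nexists>c. is_cycle F c"
  shows "\<not> (a \<in> nbrs F b \<and> b \<in> nbrs F c \<and> c \<in> nbrs F a)"
proof
  assume *: "a \<in> nbrs F b \<and> b \<in> nbrs F c \<and> c \<in> nbrs F a"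
  then have "a \<noteq> b" "b \<noteq> c" "a \<noteq> c" using not_self_nbr[OF assms(1)] by auto
  then have "is_cycle F [a, b, c]"
    using * by (auto simp: is_cycle_def cycle_edges_triangle nbrs_def)
  with assms(2) show False by blast
qed

text \<open>Greedy choice: an edge \<open>{a, b}\<close> meets at most \<open>2 * D\<close> edges
  including itself, and discarding these leaves enough edges for the next round.\<close>

lemma ex_matching:
  assumes "finite E" "\<And>e. e \<in> E \<Longrightarrow> card e = 2" "\<And>v. card {e \<in> E. v \<in> e} \<le> D"
    and "2 * D * j < card E"
  shows "\<exists>M\<subseteq>E. card M = Suc j \<and> finite M \<and> pairwise disjnt M"
  using assms
proof (induction j arbitrary: E)
  case 0
  then obtain e where "e \<in> E" by fastforce
  then show ?case by (intro exI[of _ "{e}"]) auto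
next
  case (Suc j)
  then have "E \<noteq> {}" by auto
  then obtain e where e: "e \<in> E" by blast
  obtain a b where ab: "e = {a, b}" using Suc.prems(2)[OF e] unfolding card_2_iff by blast
  let ?T = "{e' \<in> E. a \<in> e'} \<union> {e' \<in> E. b \<in> e'}"
  have "card ?T \<le> card {e' \<in> E. a \<in> e'} + card {e' \<in> E. b \<in> e'}" by (rule card_Un_le)
  also have "\<dots> \<le> D + D" by (intro add_mono Suc.prems(3))
  finally have T: "card ?T \<le> 2 * D" by simp
  have "card E - card ?T \<le> card (E - ?T)" by (intro diff_card_le_card_Diff) (simp add: Suc.prems(1))
  then have "2 * D * j < card (E - ?T)" using Suc.prems(4) T by simp
  moreover have "card {e' \<in> E - ?T. v \<in> e'} \<le> D" for v
    using Suc.prems(1) by (intro order_trans[OF card_mono Suc.prems(3)[of v]]) auto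
  ultimately have "\<exists>M\<subseteq>E - ?T. card M = Suc j \<and> finite M \<and> pairwise disjnt M"
    using Suc.prems(1,2) by (intro Suc.IH) auto
  then obtain M where M: "M \<subseteq> E - ?T" "card M = Suc j" "finite M" "pairwise disjnt M" by blast
  have "disjnt e m" if "m \<in> M" for m using M(1) that ab by (auto simp: disjnt_def)
  then have "pairwise disjnt (insert e M)" using M(4) by (auto simp: pairwise_insert disjnt_sym)
  moreover have "e \<notin> M" using M(1) e ab by auto
  ultimately show ?case using M e by (intro exI[of _ "insert e M"]) auto
qed

text \<open>Joining each of \<open>k\<close> disjoint edges to \<open>u\<close> would give
  \<open>k\<close> edge-disjoint triangles.\<close>

lemma dominating_matching_card:
  assumes G: "simple_graph n G" "\<not> has_k_edge_disjoint_cycles k G"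
    and dom: "\<And>v. v < n \<Longrightarrow> v \<noteq> u \<Longrightarrow> v \<in> nbrs G u"
    and M: "M \<subseteq> {e \<in> G. u \<notin> e}" "finite M" "pairwise disjnt M"
  shows "card M \<noteq> k"
proof
  assume "card M = k"
  then obtain f where f: "bij_betw f {0..<k} M" using ex_bij_betw_nat_finite[OF M(2)] by blast
  then have fM: "f i \<in> M" if "i < k" for i using that by (auto simp: bij_betw_def)
  have "\<exists>p. f i = {fst p, snd p} \<and> fst p \<noteq> snd p" if "i < k" for i
  proof -
    have "f i \<in> G" using fM[OF that] M(1) by blast
    then obtain a b where "f i = {a, b}" "a \<noteq> b" using simple_graph_edgeE[OF G(1)] by metis
    then show ?thesis by (intro exI[of _ "(a, b)"]) simp
  qed
  then obtain p where p: "\<And>i. i < k \<Longrightarrow> f i = {fst (p i), snd (p i)}"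
      "\<And>i. i < k \<Longrightarrow> fst (p i) \<noteq> snd (p i)" by metis
  define C where "C i = [u, fst (p i), snd (p i)]" for i
  have fG: "f i \<in> G" "u \<notin> f i" "f i \<subseteq> {..<n}" if "i < k" for i
    using fM[OF that] M(1) G(1) by (auto simp: simple_graph_def)
  have cyc: "is_cycle G (C i)" if "i < k" for i
  proof -
    have ne: "fst (p i) \<noteq> u" "snd (p i) \<noteq> u" using fG(2)[OF that] p(1)[OF that] by auto
    have lt: "fst (p i) < n" "snd (p i) < n" using fG(3)[OF that] p(1)[OF that] by auto
    have "{u, fst (p i)} \<in> G" "{snd (p i), u} \<in> G"
      using dom[OF lt(1) ne(1)] dom[OF lt(2) ne(2)] by (simp_all add: nbrs_def insert_commute)
    then show ?thesis
      using p(2)[OF that] fG(1)[OF that] ne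
      by (auto simp: is_cycle_def C_def cycle_edges_triangle p(1)[OF that])
  qed
  \<comment> \<open>Every edge of the triangle has an endpoint in \<open>f i\<close>, hence
    different from \<open>u\<close>, and no endpoint outside \<open>insert u (f i)\<close>. Disjoint
    matching edges therefore give triangles without a common edge.\<close>
  have C_edge: "\<exists>z\<in>f i. z \<in> e \<and> e \<subseteq> insert u (f i)" if "i < k" "e \<in> cycle_edges (C i)" for e i
    using that(2) unfolding p(1)[OF that(1)] by (auto simp: C_def cycle_edges_triangle)
  have "cycle_edges (C i) \<inter> cycle_edges (C j) = {}" if ij: "i < k" "j < k" "i \<noteq> j" for i j
  proof (rule ccontr)
    assume "cycle_edges (C i) \<inter> cycle_edges (C j) \<noteq> {}"
    then obtain e where e: "e \<in> cycle_edges (C i)" "e \<in> cycle_edges (C j)" by blast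
    obtain z where "z \<in> f i" "z \<in> e" using C_edge[OF ij(1) e(1)] by blast
    moreover have "e \<subseteq> insert u (f j)" using C_edge[OF ij(2) e(2)] by blast
    ultimately have "z \<in> f i \<inter> f j" using fG(2)[OF ij(1)] by blast
    moreover have "f i \<noteq> f j" using f ij by (auto simp: bij_betw_def inj_on_def)
    then have "disjnt (f i) (f j)" using M(3) fM ij by (auto simp: pairwise_def)
    ultimately show False by (auto simp: disjnt_def)
  qed
  with cyc have "has_k_edge_disjoint_cycles k G" by (rule has_k_edge_disjoint_cyclesI)
  with G(2) show False ..
qed

section \<open>Double counting of incidences and of walks\<close>

lemma card_incident_edges:
  assumes "simple_graph n G"
  shows "card {e \<in> G. v \<in> e} = card (nbrs G v)"
proof -
  have "{e \<in> G. v \<in> e} = (\<lambda>z. {z, v}) ` nbrs G v"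
  proof (intro equalityI subsetI)
    fix e assume e: "e \<in> {e \<in> G. v \<in> e}"
    then have "e \<in> G" by simp
    then obtain a b where "e = {a, b}" using simple_graph_edgeE[OF assms] by metis
    with e show "e \<in> (\<lambda>z. {z, v}) ` nbrs G v" by (auto simp: nbrs_def insert_commute)
  qed (auto simp: nbrs_def)
  moreover have "inj_on (\<lambda>z. {z, v}) (nbrs G v)" by (auto simp: inj_on_def doubleton_eq_iff)
  ultimately show ?thesis by (simp add: card_image)
qed

lemma handshake:
  assumes "simple_graph n G"
  shows "(\<Sum>v<n. card (nbrs G v)) = 2 * card G"
proof -
  have "(\<Sum>v<n. card (nbrs G v)) = (\<Sum>v<n. card {e \<in> G. v \<in> e})"
    by (simp add: card_incident_edges[OF assms])
  also have "\<dots> = (\<Sum>e\<in>G. card {v \<in> {..<n}. v \<in> e})"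
    by (intro sum_multicount_gen) (simp_all add: simple_graph_finite[OF assms])
  also have "\<dots> = (\<Sum>e\<in>G. 2)"
  proof (intro sum.cong refl)
    fix e assume "e \<in> G"
    then have "{v \<in> {..<n}. v \<in> e} = e" "card e = 2" using assms by (auto simp: simple_graph_def)
    then show "card {v \<in> {..<n}. v \<in> e} = 2" by simp
  qed
  finally show ?thesis by simp
qed

text \<open>Sorts the steps out of \<open>A\<close> by their endpoint. With \<open>A\<close> a
  neighbourhood this counts walks of length two, and the weights become codegrees.\<close>

lemma sum_nbrs_swap:
  assumes "simple_graph n G" and A: "A \<subseteq> {..<n}"
  shows "(\<Sum>v\<in>A. sum f (nbrs G v)) = (\<Sum>w<n. real (card (A \<inter> nbrs G w)) * f w)"
proof -
  have "(\<Sum>v\<in>A. sum f (nbrs G v)) = (\<Sum>v\<in>A. \<Sum>w<n. adj G v w * f w)"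
    by (simp add: sum_adj[OF assms(1)])
  also have "\<dots> = (\<Sum>w<n. \<Sum>v\<in>A. adj G v w * f w)" by (rule sum.swap)
  also have "\<dots> = (\<Sum>w<n. real (card (A \<inter> nbrs G w)) * f w)"
  proof (intro sum.cong refl)
    fix w
    have fin: "finite A" using A finite_subset by blast
    have "(\<Sum>v\<in>A. adj G v w * f w) = (\<Sum>v\<in>A. if v \<in> nbrs G w then f w else 0)"
      by (intro sum.cong refl) (simp add: adj_def nbrs_def)
    also have "\<dots> = sum (\<lambda>_. f w) (A \<inter> nbrs G w)" by (rule sum.inter_restrict[OF fin, symmetric])
    finally show "(\<Sum>v\<in>A. adj G v w * f w) = real (card (A \<inter> nbrs G w)) * f w" by simp
  qed
  finally show ?thesis .
qed

lemma sum_nbrs_swap_all: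
  assumes "simple_graph n G"
  shows "(\<Sum>v<n. sum f (nbrs G v)) = (\<Sum>w<n. real (card (nbrs G w)) * f w)"
  using sum_nbrs_swap[OF assms, of "{..<n}" f] nbrs_lessThan[OF assms] by (simp add: Int_absorb1)

section \<open>Moving a vertex; dominating vertices\<close>

lemma leaf_notin_cycle:
  assumes "is_cycle G c" "nbrs G w \<subseteq> {u}"
  shows "w \<notin> set c"
proof
  assume "w \<in> set c"
  then obtain a b where "a \<noteq> b" "a \<in> nbrs G w" "b \<in> nbrs G w"
    using cycle_vertex_two_nbrs[OF assms(1)] by metis
  with assms(2) show False by blast
qed

text \<open>The competitor of an extremal graph: \<open>w\<close> gives up all its edges in exchange
  for the single edge to \<open>u\<close>.\<close>

definition pendant_at :: "nat set set \<Rightarrow> nat \<Rightarrow> nat \<Rightarrow> nat set set" where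
  "pendant_at G u w = insert {u, w} {e \<in> G. w \<notin> e}"

lemma simple_graph_pendant_at:
  "simple_graph n G \<Longrightarrow> u < n \<Longrightarrow> w < n \<Longrightarrow> u \<noteq> w \<Longrightarrow> simple_graph n (pendant_at G u w)"
  by (simp add: simple_graph_def pendant_at_def)

lemma nbrs_pendant_at: "nbrs (pendant_at G u w) w = {u}"
  by (auto simp: nbrs_def pendant_at_def doubleton_eq_iff)

text \<open>A vertex with a single neighbour lies on no cycle, so every cycle of the new graph
  already lives in \<open>G\<close>.\<close>

lemma pendant_at_no_k_cycles:
  assumes "\<not> has_k_edge_disjoint_cycles k G"
  shows "\<not> has_k_edge_disjoint_cycles k (pendant_at G u w)"
proof
  assume "has_k_edge_disjoint_cycles k (pendant_at G u w)"
  then obtain C where C: "\<forall>i<k. is_cycle (pendant_at G u w) (C i)"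
    "\<forall>i<k. \<forall>j<k. i \<noteq> j \<longrightarrow> cycle_edges (C i) \<inter> cycle_edges (C j) = {}"
    unfolding has_k_edge_disjoint_cycles_def by blast
  have "is_cycle G (C i)" if "i < k" for i
  proof -
    have c: "is_cycle (pendant_at G u w) (C i)" using C(1) that by blast
    have w: "w \<notin> set (C i)" by (rule leaf_notin_cycle[OF c, of w u]) (simp add: nbrs_pendant_at)
    have "e \<in> G" if e: "e \<in> cycle_edges (C i)" for e
    proof -
      have "e \<in> pendant_at G u w" using c e by (auto simp: is_cycle_def)
      moreover have "w \<notin> e" using cycle_edge_subset[OF e] w by blast
      ultimately show ?thesis by (auto simp: pendant_at_def)
    qed
    then show ?thesis using c by (auto simp: is_cycle_def)
  qed
  moreover have "cycle_edges (C i) \<inter> cycle_edges (C j) = {}" if "i < k" "j < k" "i \<noteq> j" for i j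
    using C(2) that by blast
  ultimately have "has_k_edge_disjoint_cycles k G" by (rule has_k_edge_disjoint_cyclesI)
  with assms show False ..
qed

text \<open>Test the Rayleigh bound of the rewired graph with \<open>x\<close> changed only at
  \<open>w\<close>. Removing the edges at \<open>w\<close> costs
  \<open>2 * \<rho> * (x w)\<^sup>2\<close>, a new entry \<open>t\<close> gains
  \<open>2 * t\<close>, and \<open>t\<close> can be chosen freely.\<close>

lemma extremal_perron_entry_lower:
  assumes G: "simple_graph n G" and u: "u < n" "x u = 1" and w: "w < n" "w \<noteq> u"
    and eig: "\<And>i. i < n \<Longrightarrow> sum x (nbrs G i) = \<rho> * x i" and pos: "0 < \<rho>" "0 \<le> x w"
    and max: "\<And>z. quad_form n (adj (pendant_at G u w)) z \<le> \<rho> * (\<Sum>i<n. (z i)\<^sup>2)"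
  shows "1 \<le> \<rho> * x w"
proof -
  let ?G = "pendant_at G u w"
  have G': "simple_graph n ?G" using simple_graph_pendant_at[OF G u(1) w(1)] w(2) by simp
  \<comment> \<open>With the entry at \<open>w\<close> set to 0 the two graphs have the same
    quadratic form, as they differ only in edges at \<open>w\<close>.\<close>
  define x0 where "x0 = x(w := 0)"
  have x0_upd: "x0(w := x0 w + t) = x(w := t)" for t by (simp add: x0_def)
  have q0: "quad_form n (adj ?G) x0 = quad_form n (adj G) x0"
    unfolding quad_form_def
  proof (intro sum.cong refl)
    fix i j
    show "adj ?G i j * x0 i * x0 j = adj G i j * x0 i * x0 j"
    proof (cases "i = w \<or> j = w")
      case True
      then have "x0 i * x0 j = 0" by (auto simp: x0_def)
      then show ?thesis by auto
    next
      case False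
      then have "{i, j} \<in> ?G \<longleftrightarrow> {i, j} \<in> G" by (auto simp: pendant_at_def)
      then show ?thesis by (simp add: adj_def)
    qed
  qed
  have self: "adj G w w = 0" "adj ?G w w = 0"
    using not_self_nbr[OF G, of w] not_self_nbr[OF G', of w] by (auto simp: adj_def nbrs_def)
  have "sum x0 (nbrs G w) = sum x (nbrs G w)"
    using not_self_nbr[OF G, of w] by (intro sum.cong refl) (auto simp: x0_def)
  then have "quad_form n (adj G) (x(w := x w)) = quad_form n (adj G) x0 + 2 * x w * (\<rho> * x w)"
    using quad_form_update[of "adj G" w n x0 "x w", OF adj_sym w(1)]
    by (simp only: x0_upd sum_adj[OF G] self eig[OF w(1)])
  moreover have "quad_form n (adj G) x = \<rho> * (\<Sum>i<n. (x i)\<^sup>2)"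
  proof -
    have "quad_form n (adj G) x = (\<Sum>i<n. x i * (\<Sum>j<n. adj G i j * x j))"
      by (simp add: quad_form_def sum_distrib_left mult_ac)
    also have "\<dots> = (\<Sum>i<n. \<rho> * (x i)\<^sup>2)"
      by (intro sum.cong refl) (simp add: sum_adj[OF G] eig power2_eq_square)
    finally show ?thesis by (simp add: sum_distrib_left)
  qed
  ultimately have q: "quad_form n (adj G) x0 = \<rho> * (\<Sum>i<n. (x i)\<^sup>2) - 2 * \<rho> * (x w)\<^sup>2"
    by (simp add: power2_eq_square)
  \<comment> \<open>This value maximises the net gain
    \<open>2 * t - \<rho> * t\<^sup>2\<close>.\<close>
  define t where "t = 1 / \<rho>"
  have "sum x0 (nbrs ?G w) = 1" using w u by (simp add: nbrs_pendant_at x0_def)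
  then have "quad_form n (adj ?G) (x(w := t)) = quad_form n (adj G) x0 + 2 * t"
    using quad_form_update[of "adj ?G" w n x0 t, OF adj_sym w(1)]
    by (simp add: x0_upd sum_adj[OF G'] self q0)
  moreover have "(\<Sum>i<n. ((x(w := t)) i)\<^sup>2) = (\<Sum>i<n. (x i)\<^sup>2) - (x w)\<^sup>2 + t\<^sup>2"
  proof -
    have "2 * (t - x w) * x w + (t - x w)\<^sup>2 = t\<^sup>2 - (x w)\<^sup>2"
      by (simp add: power2_eq_square algebra_simps)
    then show ?thesis using sum_square_update[OF w(1), of x "t - x w"] by simp
  qed
  moreover note max[of "x(w := t)"]
  ultimately have "\<rho> * (\<Sum>i<n. (x i)\<^sup>2) - 2 * \<rho> * (x w)\<^sup>2 + 2 * t \<le>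
      \<rho> * ((\<Sum>i<n. (x i)\<^sup>2) - (x w)\<^sup>2 + t\<^sup>2)"
    by (simp only: q)
  then have "2 * t \<le> \<rho> * (x w)\<^sup>2 + \<rho> * t\<^sup>2" by (simp add: algebra_simps)
  also have "\<rho> * t\<^sup>2 = t" using pos by (simp add: t_def power2_eq_square)
  finally have "\<rho> * t \<le> \<rho> * (\<rho> * (x w)\<^sup>2)" using pos by (intro mult_left_mono) auto
  then have "1\<^sup>2 \<le> (\<rho> * x w)\<^sup>2" using pos by (simp add: t_def power2_eq_square mult_ac)
  then show ?thesis by (rule power2_le_imp_le) (use pos in simp)
qed

text \<open>Here the vector is normalised at the dominating vertex, where its maximum need not be
  known to lie. This is possible because \<open>x u = 0\<close> would force all neighbours of
  \<open>u\<close>, hence the whole vector, to vanish.\<close>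

lemma dominating_perron:
  assumes n: "u < n" and G: "simple_graph n G"
    and dom: "\<And>v. v < n \<Longrightarrow> v \<noteq> u \<Longrightarrow> v \<in> nbrs G u"
  obtains x where "x u = 1" "\<And>i. 0 \<le> x i"
    "\<And>i. i < n \<Longrightarrow> sum x (nbrs G i) = spectral_radius_graph n G * x i"
proof -
  let ?\<rho> = "spectral_radius_graph n G"
  have "0 < n" using n by simp
  then obtain x w where w: "w < n" "x w = 1" and x: "\<And>i. 0 \<le> x i"
      and eig: "\<And>i. i < n \<Longrightarrow> sum x (nbrs G i) = ?\<rho> * x i"
    using perron_graph[OF _ G] by metis
  have "x u \<noteq> 0"
  proof
    assume xu: "x u = 0"
    then have "w \<noteq> u" using w by auto
    then have "x w \<le> sum x (nbrs G u)"
      using dom w x finite_nbrs[OF G] by (intro member_le_sum) auto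
    also have "\<dots> = 0" using eig[OF n] xu by simp
    finally show False using w by simp
  qed
  then have xu: "0 < x u" using x[of u] by simp
  have "sum (\<lambda>i. x i / x u) (nbrs G i) = ?\<rho> * (x i / x u)" if "i < n" for i
    using eig[OF that] by (simp flip: sum_divide_distrib)
  then show thesis using xu x by (intro that[of "\<lambda>i. x i / x u"]) auto
qed

text \<open>For \<open>v \<noteq> u\<close> the eigenvalue equation reads
  \<open>\<rho> * x v = 1 + sum x (nbrs H v)\<close>. Substituting it into the equation at
  \<open>u\<close> gives the first identity, and substituting it once more gives the second, where
  the constant terms add up to the degree sum of \<open>H\<close>.\<close>

lemma dominating_identity:
  fixes \<rho> :: real
  assumes u: "u < n" and G: "simple_graph n G"
    and dom: "\<And>v. v < n \<Longrightarrow> v \<noteq> u \<Longrightarrow> v \<in> nbrs G u"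
    and xu: "x u = 1" and eig: "\<And>i. i < n \<Longrightarrow> sum x (nbrs G i) = \<rho> * x i"
  defines "H \<equiv> {e \<in> G. u \<notin> e}"
  shows "\<rho>\<^sup>2 = real (n - 1) + (\<Sum>v<n. real (card (nbrs H v)) * x v)"
    and "\<rho> * (\<rho>\<^sup>2 - real (n - 1)) =
      2 * real (card H) + (\<Sum>v<n. real (card (nbrs H v)) * sum x (nbrs H v))"
    and "card G = n - 1 + card H"
proof -
  have H: "simple_graph n H" by (rule simple_graph_subset[OF G]) (auto simp: H_def)
  have Nu: "nbrs G u = {..<n} - {u}" using dom nbrs_lessThan[OF G] not_self_nbr[OF G] by blast
  have Hu: "nbrs H u = {}" by (auto simp: H_def nbrs_def)
  have Nv: "nbrs G v = insert u (nbrs H v)" if "v < n" "v \<noteq> u" for v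
    using dom[OF that] that(2) by (auto simp: H_def nbrs_def insert_commute)
  have fin: "finite (nbrs H v)" for v by (rule finite_nbrs[OF H])
  have uH: "u \<notin> nbrs H v" for v by (auto simp: H_def nbrs_def)
  have eig': "\<rho> * x v = 1 + sum x (nbrs H v)" if "v < n" "v \<noteq> u" for v
    using eig[OF that(1)] Nv[OF that] fin uH xu by simp
  have "\<rho> = sum x ({..<n} - {u})" using eig[OF u] Nu xu by simp
  then have "\<rho>\<^sup>2 = (\<Sum>v\<in>{..<n} - {u}. \<rho> * x v)"
    by (simp add: power2_eq_square flip: sum_distrib_left)
  also have "\<dots> = (\<Sum>v\<in>{..<n} - {u}. 1 + sum x (nbrs H v))"
    by (intro sum.cong refl) (auto intro: eig')
  also have "\<dots> = real (n - 1) + (\<Sum>v\<in>{..<n} - {u}. sum x (nbrs H v))"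
    using u by (simp add: sum.distrib)
  also have "(\<Sum>v\<in>{..<n} - {u}. sum x (nbrs H v)) = (\<Sum>v<n. sum x (nbrs H v))"
    using u Hu by (simp add: sum.remove[of "{..<n}" u])
  also have "\<dots> = (\<Sum>v<n. real (card (nbrs H v)) * x v)" by (rule sum_nbrs_swap_all[OF H])
  finally show 1: "\<rho>\<^sup>2 = real (n - 1) + (\<Sum>v<n. real (card (nbrs H v)) * x v)" .
  have "\<rho> * (\<rho>\<^sup>2 - real (n - 1)) = (\<Sum>v<n. real (card (nbrs H v)) * (\<rho> * x v))"
    unfolding 1 by (simp add: sum_distrib_left mult_ac)
  also have "\<dots> = (\<Sum>v<n. real (card (nbrs H v)) + real (card (nbrs H v)) * sum x (nbrs H v))"
  proof (intro sum.cong refl)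
    fix v assume v: "v \<in> {..<n}"
    show "real (card (nbrs H v)) * (\<rho> * x v) =
        real (card (nbrs H v)) + real (card (nbrs H v)) * sum x (nbrs H v)"
    proof (cases "v = u")
      case False
      then show ?thesis using eig'[of v] v by (simp add: algebra_simps)
    qed (simp add: Hu)
  qed
  also have "\<dots> = real (\<Sum>v<n. card (nbrs H v)) + (\<Sum>v<n. real (card (nbrs H v)) * sum x (nbrs H v))"
    by (simp add: sum.distrib)
  finally show "\<rho> * (\<rho>\<^sup>2 - real (n - 1)) =
      2 * real (card H) + (\<Sum>v<n. real (card (nbrs H v)) * sum x (nbrs H v))"
    by (simp add: handshake[OF H])
  have "G = {e \<in> G. u \<in> e} \<union> H" "{e \<in> G. u \<in> e} \<inter> H = {}" by (auto simp: H_def)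
  then have "card G = card {e \<in> G. u \<in> e} + card H"
    using simple_graph_finite[OF G] by (metis card_Un_disjoint finite_Un)
  then show "card G = n - 1 + card H" using card_incident_edges[OF G, of u] Nu u by simp
qed

lemma dominating_lower:
  assumes u: "u < n" and G: "simple_graph n G"
    and dom: "\<And>v. v < n \<Longrightarrow> v \<noteq> u \<Longrightarrow> v \<in> nbrs G u"
  defines "\<rho> \<equiv> spectral_radius_graph n G"
  shows "real (n - 1) \<le> \<rho>\<^sup>2" "0 \<le> \<rho>"
    "2 * (real (card G) - real (n - 1)) \<le> \<rho> * (\<rho>\<^sup>2 - real (n - 1))"
proof -
  obtain x where x: "x u = 1" "\<And>i. 0 \<le> x i" "\<And>i. i < n \<Longrightarrow> sum x (nbrs G i) = \<rho> * x i"
    using dominating_perron[OF u G dom] unfolding \<rho>_def by metis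
  note id = dominating_identity[OF u G dom x(1,3)]
  show "real (n - 1) \<le> \<rho>\<^sup>2" using id(1) x(2) by (simp add: sum_nonneg)
  show "0 \<le> \<rho>" using x(3)[OF u] x(1,2) by (metis mult.right_neutral sum_nonneg)
  show "2 * (real (card G) - real (n - 1)) \<le> \<rho> * (\<rho>\<^sup>2 - real (n - 1))"
    using id(2,3) x(2) by (simp add: sum_nonneg)
qed

text \<open>Every neighbour in the graph without \<open>u\<close> is a common neighbour with
  \<open>u\<close>, so degrees there are at most \<open>a\<close>. This keeps all entries other than
  \<open>x u\<close> below \<open>1 / (\<rho> - a)\<close> and bounds the error term of the second
  identity.\<close>

lemma dominating_upper:
  assumes u: "u < n" and G: "simple_graph n G"
    and dom: "\<And>v. v < n \<Longrightarrow> v \<noteq> u \<Longrightarrow> v \<in> nbrs G u"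
    and deg: "\<And>v. v < n \<Longrightarrow> v \<noteq> u \<Longrightarrow> card (nbrs G u \<inter> nbrs G v) \<le> a"
  defines "\<rho> \<equiv> spectral_radius_graph n G"
  assumes a: "real a < \<rho>"
  shows "\<rho> * (\<rho>\<^sup>2 - real (n - 1)) \<le> 2 * (real (card G) - real (n - 1)) * (1 + real a / (\<rho> - real a))"
proof -
  obtain x where x: "x u = 1" "\<And>i. 0 \<le> x i" "\<And>i. i < n \<Longrightarrow> sum x (nbrs G i) = \<rho> * x i"
    using dominating_perron[OF u G dom] unfolding \<rho>_def by metis
  note id = dominating_identity[OF u G dom x(1,3)]
  let ?H = "{e \<in> G. u \<notin> e}"
  have H: "simple_graph n ?H" by (rule simple_graph_subset[OF G]) auto
  have degH: "card (nbrs ?H v) \<le> a" if "v < n" for v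
  proof (cases "v = u")
    case True
    then have "nbrs ?H v = {}" by (auto simp: nbrs_def)
    then show ?thesis by simp
  next
    case False
    have "nbrs ?H v \<subseteq> nbrs G u \<inter> nbrs G v"
    proof
      fix z assume z: "z \<in> nbrs ?H v"
      then have "z \<noteq> u" "z < n" "z \<in> nbrs G v"
        using nbrs_lessThan[OF H] by (auto simp: nbrs_def)
      then show "z \<in> nbrs G u \<inter> nbrs G v" using dom by blast
    qed
    then show ?thesis using deg[OF that False] card_mono finite_nbrs[OF G]
      by (metis finite_Int le_trans)
  qed
  have small: "x v \<le> 1 / (\<rho> - real a)" if "v < n" "v \<noteq> u" for v
  proof -
    let ?A = "{..<n} - {u}"
    \<comment> \<open>At the vertex attaining the maximum \<open>y\<close>, the eigenvalue equation
      gives \<open>\<rho> * y \<le> 1 + a * y\<close>.\<close>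
    define y where "y = Max (x ` ?A)"
    have fin: "finite (x ` ?A)" "x ` ?A \<noteq> {}" using that by auto
    obtain w where w: "w \<in> ?A" "x w = y" using Max_in[OF fin] unfolding y_def by (metis imageE)
    have le: "x z \<le> y" if "z \<in> ?A" for z using fin that unfolding y_def by (intro Max_ge) auto
    have y0: "0 \<le> y" using w x(2) by metis
    have "\<rho> * y = sum x (nbrs G w)" using x(3)[of w] w by simp
    also have "nbrs G w = insert u (nbrs ?H w)"
      using dom[of w] w(1) by (auto simp: nbrs_def insert_commute)
    also have "sum x \<dots> = 1 + sum x (nbrs ?H w)"
      using x(1) finite_nbrs[OF H] by (subst sum.insert) (auto simp: nbrs_def)
    also have "sum x (nbrs ?H w) \<le> real (card (nbrs ?H w)) * y"
      using nbrs_lessThan[OF H] by (intro sum_bounded_above le) (auto simp: nbrs_def)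
    also have "\<dots> \<le> real a * y" using degH[of w] w y0 by (intro mult_right_mono) auto
    finally have "y * (\<rho> - real a) \<le> 1" by (simp add: algebra_simps)
    then have "y \<le> 1 / (\<rho> - real a)" using a by (simp add: field_simps)
    then show ?thesis using le[of v] that by simp
  qed
  have "(\<Sum>v<n. real (card (nbrs ?H v)) * sum x (nbrs ?H v)) \<le>
      (\<Sum>v<n. real (card (nbrs ?H v)) * (real a / (\<rho> - real a)))"
  proof (intro sum_mono mult_left_mono)
    fix v assume v: "v \<in> {..<n}"
    have "sum x (nbrs ?H v) \<le> real (card (nbrs ?H v)) * (1 / (\<rho> - real a))"
      using nbrs_lessThan[OF H] by (intro sum_bounded_above small) (auto simp: nbrs_def)
    also have "\<dots> \<le> real a * (1 / (\<rho> - real a))"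
      using degH[of v] v a by (intro mult_right_mono) auto
    finally show "sum x (nbrs ?H v) \<le> real a / (\<rho> - real a)" by simp
  qed simp
  also have "\<dots> = real (\<Sum>v<n. card (nbrs ?H v)) * (real a / (\<rho> - real a))"
    by (simp only: sum_distrib_right of_nat_sum)
  also have "\<dots> = 2 * real (card ?H) * (real a / (\<rho> - real a))"
    by (simp add: handshake[OF H])
  finally have "\<rho> * (\<rho>\<^sup>2 - real (n - 1)) \<le>
      2 * real (card ?H) + 2 * real (card ?H) * (real a / (\<rho> - real a))"
    using id(2) by linarith
  also have "real (card ?H) = real (card G) - real (n - 1)" using id(3) by linarith
  finally show ?thesis by (simp only: distrib_left mult_1_right)
qed

section \<open>Locating the vertex of large degree\<close>

text \<open>A forest \<open>F\<close> together with a remainder of maximum degree at most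
  \<open>K\<close>. Only a nonnegative eigenvector with maximum at \<open>u\<close> is assumed;
  extremality of \<open>G\<close> does not enter. For \<open>k\<close> cycles, \<open>K\<close> will
  be \<open>2 * (k - 1)\<close>.\<close>

locale forest_split =
  fixes n :: nat and G F :: "nat set set" and K :: nat and x :: "nat \<Rightarrow> real" and \<rho> :: real and u :: nat
  assumes G: "simple_graph n G" and F: "F \<subseteq> G" "\<nexists>c. is_cycle F c"
    and deg_rest: "\<And>v. card (nbrs (G - F) v) \<le> K"
    and codeg: "\<And>v. v \<noteq> u \<Longrightarrow> card (nbrs G u \<inter> nbrs G v) \<le> K + 1"
    and x_nonneg: "\<And>v. 0 \<le> x v" and x_le_1: "\<And>v. v < n \<Longrightarrow> x v \<le> 1"
    and u: "u < n" "x u = 1"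
    and eig: "\<And>v. v < n \<Longrightarrow> sum x (nbrs G v) = \<rho> * x v"
    and rho_pos: "0 < \<rho>"
begin

abbreviation NF where "NF \<equiv> nbrs F"
abbreviation NB where "NB \<equiv> nbrs (G - F)"

lemma simple_F: "simple_graph n F"
  using simple_graph_subset[OF G F(1)] .

lemma simple_B: "simple_graph n (G - F)"
  by (rule simple_graph_subset[OF G]) auto

lemmas finite_NF = finite_nbrs[OF simple_F] and finite_NB = finite_nbrs[OF simple_B]
lemmas NF_lt = nbrs_lessThan[OF simple_F] and NB_lt = nbrs_lessThan[OF simple_B]

lemma nbrs_split: "nbrs G v = NF v \<union> NB v" "NF v \<inter> NB v = {}"
  using F(1) by (auto simp: nbrs_def)

lemma sum_nbrs_split: "sum x (nbrs G v) = sum x (NF v) + sum x (NB v)"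
  unfolding nbrs_split(1) by (rule sum.union_disjoint) (simp_all add: finite_NF finite_NB nbrs_split(2))

lemma sum_nbrs_split_u:
  "sum x (nbrs G v) = of_bool (u \<in> nbrs G v) + sum x (NF v - {u}) + sum x (NB v - {u})"
proof -
  have "nbrs G v = (NF v - {u}) \<union> (NB v - {u}) \<union> (nbrs G v \<inter> {u})"
    using nbrs_split(1)[of v] by auto
  then have "sum x (nbrs G v) = sum x ((NF v - {u}) \<union> (NB v - {u}) \<union> (nbrs G v \<inter> {u}))"
    by (rule arg_cong)
  also have "\<dots> = sum x ((NF v - {u}) \<union> (NB v - {u})) + sum x (nbrs G v \<inter> {u})"
    by (rule sum.union_disjoint) (auto simp: finite_NF finite_NB)
  also have "sum x ((NF v - {u}) \<union> (NB v - {u})) = sum x (NF v - {u}) + sum x (NB v - {u})"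
    using nbrs_split(2)[of v] by (intro sum.union_disjoint) (auto simp: finite_NF finite_NB)
  also have "sum x (nbrs G v \<inter> {u}) = of_bool (u \<in> nbrs G v)" using u(2) by simp
  finally show ?thesis by simp
qed

section \<open>Walk counts from the heaviest and the second heaviest vertex\<close>

abbreviation S where "S \<equiv> \<Sum>v<n. x v"
abbreviation d where "d \<equiv> real (card (NF u))"
abbreviation R where "R \<equiv> real (card {e \<in> F. u \<notin> e})"

lemma sum_NB_le: "(\<Sum>v<n. sum x (NB v)) \<le> real K * S"
proof -
  have "(\<Sum>v<n. sum x (NB v)) = (\<Sum>v<n. real (card (NB v)) * x v)"
    by (rule sum_nbrs_swap_all[OF simple_B])
  also have "\<dots> \<le> (\<Sum>v<n. real K * x v)"
    by (intro sum_mono mult_right_mono x_nonneg) (simp add: deg_rest)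
  finally show ?thesis by (simp add: sum_distrib_left)
qed

lemma card_F: "card F \<le> n - 1"
proof -
  have "{e \<in> F. e \<subseteq> {..<n}} = F" using simple_F by (auto simp: simple_graph_def)
  then show ?thesis
    using acyclic_card_edges[OF simple_F F(2), of "{..<n}"] u(1) by fastforce
qed

text \<open>Add up all eigenvalue equations: the forest contributes at most twice its number of
  edges, the remainder at most \<open>K * S\<close>.\<close>

lemma sum_entries_le: "(\<rho> - real K) * S \<le> 2 * real (n - 1)"
proof -
  have "\<rho> * S = (\<Sum>v<n. sum x (nbrs G v))" by (simp add: sum_distrib_left eig)
  also have "\<dots> = (\<Sum>v<n. sum x (NF v)) + (\<Sum>v<n. sum x (NB v))"
    by (simp add: sum_nbrs_split sum.distrib)
  also have "(\<Sum>v<n. sum x (NF v)) = (\<Sum>v<n. real (card (NF v)) * x v)"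
    by (rule sum_nbrs_swap_all[OF simple_F])
  also have "\<dots> \<le> (\<Sum>v<n. real (card (NF v)) * 1)"
    by (intro sum_mono mult_left_mono) (auto intro: x_le_1)
  also have "\<dots> = real (\<Sum>v<n. card (NF v))" by simp
  also have "\<dots> = 2 * real (card F)" unfolding handshake[OF simple_F] by simp
  also have "\<dots> \<le> 2 * real (n - 1)" using card_F by simp
  finally show ?thesis using sum_NB_le by (simp add: algebra_simps)
qed

text \<open>In a forest two distinct vertices have at most one common neighbour, so each
  \<open>w \<noteq> u\<close> is reached at most once; the walks returning to \<open>u\<close>
  account for \<open>d\<close>.\<close>

lemma forest_two_walks_le: "(\<Sum>v\<in>NF u. sum x (NF v)) \<le> d + S"
proof -
  have "(\<Sum>v\<in>NF u. sum x (NF v)) = (\<Sum>w<n. real (card (NF u \<inter> NF w)) * x w)"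
    by (rule sum_nbrs_swap[OF simple_F NF_lt])
  also have "\<dots> \<le> (\<Sum>w<n. (if w = u then d else 0) + x w)"
  proof (rule sum_mono)
    fix w assume w: "w \<in> {..<n}"
    show "real (card (NF u \<inter> NF w)) * x w \<le> (if w = u then d else 0) + x w"
    proof (cases "w = u")
      case False
      then have "card (NF u \<inter> NF w) < 2 * 1"
        using codegree_less[OF simple_F, of 1 u w] F(2) acyclic_iff_no_1_cycle by blast
      then have "real (card (NF u \<inter> NF w)) \<le> 1" by simp
      then have "real (card (NF u \<inter> NF w)) * x w \<le> 1 * x w"
        by (intro mult_right_mono x_nonneg)
      then show ?thesis using False by simp
    qed (simp add: u)
  qed
  also have "\<dots> = d + S" using u(1) by (simp add: sum.distrib)
  finally show ?thesis .
qed

text \<open>Two steps from \<open>u\<close>: two forest edges give at most \<open>d + S\<close>, a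
  forest edge followed by a remaining one at most \<open>K * S\<close>, and a remaining edge first
  at most \<open>K * \<rho>\<close>.\<close>

lemma rho_square_le: "\<rho>\<^sup>2 \<le> d + real (K + 1) * S + real K * \<rho>"
proof -
  have "\<rho>\<^sup>2 = \<rho> * sum x (nbrs G u)" using eig[OF u(1)] u(2) by (simp add: power2_eq_square)
  also have "\<dots> = (\<Sum>v\<in>NF u. \<rho> * x v) + \<rho> * sum x (NB u)"
    by (simp add: sum_nbrs_split distrib_left sum_distrib_left)
  also have "\<rho> * sum x (NB u) \<le> \<rho> * real K"
  proof (rule mult_left_mono)
    have "sum x (NB u) \<le> real (card (NB u)) * 1"
      using NB_lt by (intro sum_bounded_above x_le_1) auto
    also have "\<dots> \<le> real K" by (simp add: deg_rest)
    finally show "sum x (NB u) \<le> real K" .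
  qed (use rho_pos in simp)
  also have "(\<Sum>v\<in>NF u. \<rho> * x v) = (\<Sum>v\<in>NF u. sum x (NF v) + sum x (NB v))"
    using NF_lt[of u] by (intro sum.cong refl) (auto simp: sum_nbrs_split simp flip: eig)
  also have "\<dots> = (\<Sum>v\<in>NF u. sum x (NF v)) + (\<Sum>v\<in>NF u. sum x (NB v))" by (rule sum.distrib)
  also have "(\<Sum>v\<in>NF u. sum x (NB v)) \<le> (\<Sum>v<n. sum x (NB v))"
    by (intro sum_mono2 NF_lt) (auto intro: sum_nonneg x_nonneg)
  finally show ?thesis using forest_two_walks_le sum_NB_le by (simp add: algebra_simps)
qed

lemma R_le: "R \<le> real (n - 1) - d"
proof -
  have fin: "finite F" using simple_graph_finite[OF simple_F] .
  have "F = {e \<in> F. u \<in> e} \<union> {e \<in> F. u \<notin> e}" by auto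
  then have "card F = card {e \<in> F. u \<in> e} + card {e \<in> F. u \<notin> e}"
    using fin card_Un_disjoint[of "{e \<in> F. u \<in> e}" "{e \<in> F. u \<notin> e}"] by auto
  then show ?thesis using card_F card_incident_edges[OF simple_F, of u] by linarith
qed

lemma card_NF_minus_le: "v \<noteq> u \<Longrightarrow> real (card (NF v - {u})) \<le> R"
proof -
  assume v: "v \<noteq> u"
  have fin: "finite F" using simple_graph_finite[OF simple_F] .
  have "card (NF v - {u}) = card ((\<lambda>z. {z, v}) ` (NF v - {u}))"
    by (rule card_image[symmetric]) (auto simp: inj_on_def doubleton_eq_iff)
  also have "\<dots> \<le> card {e \<in> F. u \<notin> e}"
    using fin v by (intro card_mono) (auto simp: nbrs_def)
  finally show ?thesis by simp
qed

text \<open>In a triangle-free graph, an edge has at most one endpoint adjacent to \<open>v\<close>, so it is the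
  second edge of at most one walk of length two from \<open>v\<close>.\<close>

lemma forest_two_walks_avoiding_u:
  "(\<Sum>z\<in>NF v - {u}. real (card (NF z - {u}))) \<le> R"
proof -
  let ?P = "SIGMA z:NF v - {u}. NF z - {u}"
  let ?f = "\<lambda>(z, w). {z, w}"
  have fin: "finite F" using simple_graph_finite[OF simple_F] .
  have "inj_on ?f ?P"
  proof (rule inj_onI)
    fix p q assume pq: "p \<in> ?P" "q \<in> ?P" "?f p = ?f q"
    obtain z w z' w' where [simp]: "p = (z, w)" "q = (z', w')" by (cases p, cases q)
    have z: "z \<in> NF v" "w \<in> NF z" "z' \<in> NF v" and eq: "{z, w} = {z', w'}" using pq by auto
    have "\<not> (z = w' \<and> w = z')"
    proof
      assume "z = w' \<and> w = z'"
      then have "z \<in> NF v \<and> v \<in> NF w \<and> w \<in> NF z" using z nbrs_sym by blast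
      then show False using acyclic_no_triangle[OF simple_F F(2), of z v w] by blast
    qed
    then show "p = q" using eq by (auto simp: doubleton_eq_iff)
  qed
  then have "card ?P = card (?f ` ?P)" by (rule card_image[symmetric])
  also have "\<dots> \<le> card {e \<in> F. u \<notin> e}"
    using fin by (intro card_mono) (auto simp: nbrs_def insert_commute)
  finally have "card ?P \<le> card {e \<in> F. u \<notin> e}" .
  moreover have "card ?P = (\<Sum>z\<in>NF v - {u}. card (NF z - {u}))"
    by (rule card_SigmaI) (auto simp: finite_NF)
  ultimately show ?thesis by (simp flip: of_nat_sum)
qed

text \<open>Two steps from the heaviest vertex other than \<open>u\<close>. Walks ending in
  \<open>u\<close> go through common neighbours and give at most \<open>K + 1\<close>; forest walks
  avoiding \<open>u\<close> give at most \<open>R\<close> entries, a forest edge followed by a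
  remaining one at most \<open>R * K\<close>. A first step to \<open>u\<close> costs
  \<open>\<rho>\<close>, and a first step along a remaining edge at most
  \<open>K * \<rho> * x v\<close>.\<close>

lemma second_entry_le:
  assumes v: "v < n" "v \<noteq> u" and max: "\<And>w. w < n \<Longrightarrow> w \<noteq> u \<Longrightarrow> x w \<le> x v"
  shows "x v * (\<rho>\<^sup>2 - real K * \<rho> - real (K + 1) * R) \<le> \<rho> + real (K + 1)"
proof -
  let ?y = "x v"
  have y: "0 \<le> ?y" by (rule x_nonneg)
  have sum_le: "sum x (A - {u}) \<le> real (card (A - {u})) * ?y" if "A \<subseteq> {..<n}" for A
    using that by (intro sum_bounded_above max) auto
  have NB_le: "sum x (NB z - {u}) \<le> real K * ?y" for z
  proof -
    have "card (NB z - {u}) \<le> K"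
      by (rule order_trans[OF card_mono deg_rest[of z]]) (auto simp: finite_NB)
    then have "real (card (NB z - {u})) * ?y \<le> real K * ?y" by (intro mult_right_mono y) simp
    then show ?thesis using sum_le[OF NB_lt, of z] by linarith
  qed
  have common: "(\<Sum>z\<in>NF v - {u}. of_bool (u \<in> nbrs G z)) \<le> real (K + 1)"
  proof -
    let ?A = "(NF v - {u}) \<inter> {z. u \<in> nbrs G z}"
    have "?A \<subseteq> nbrs G u \<inter> nbrs G v"
      using nbrs_mono[OF F(1), of v] nbrs_sym[of u G] by blast
    then have "card ?A \<le> card (nbrs G u \<inter> nbrs G v)"
      by (rule card_mono[rotated]) (simp add: finite_nbrs[OF G])
    also have "\<dots> \<le> K + 1" by (rule codeg[OF v(2)])
    finally have "real (card ?A) \<le> real (K + 1)" by (rule of_nat_mono)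
    then show ?thesis using finite_NF by (simp add: sum_of_bool_eq)
  qed
  have "\<rho> * sum x (NF v - {u}) = (\<Sum>z\<in>NF v - {u}. sum x (nbrs G z))"
    unfolding sum_distrib_left using NF_lt[of v] by (intro sum.cong refl) (auto simp: eig)
  also have "\<dots> \<le> (\<Sum>z\<in>NF v - {u}. of_bool (u \<in> nbrs G z) + real (card (NF z - {u})) * ?y + real K * ?y)"
    unfolding sum_nbrs_split_u by (intro sum_mono add_mono order_refl sum_le NF_lt NB_le)
  also have "\<dots> = (\<Sum>z\<in>NF v - {u}. of_bool (u \<in> nbrs G z)) +
      (\<Sum>z\<in>NF v - {u}. real (card (NF z - {u}))) * ?y + real (card (NF v - {u})) * (real K * ?y)"
    by (simp add: sum.distrib sum_distrib_right)
  also have "\<dots> \<le> real (K + 1) + R * ?y + R * (real K * ?y)"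
    using common y by (intro add_mono mult_right_mono forest_two_walks_avoiding_u card_NF_minus_le v(2)) simp_all
  finally have *: "\<rho> * sum x (NF v - {u}) \<le> real (K + 1) + R * ?y + R * (real K * ?y)" .
  have "\<rho> * ?y \<le> 1 + sum x (NF v - {u}) + real K * ?y"
    unfolding eig[OF v(1), symmetric] sum_nbrs_split_u by (intro add_mono NB_le) auto
  then have "\<rho> * (\<rho> * ?y) \<le> \<rho> * (1 + sum x (NF v - {u}) + real K * ?y)"
    using rho_pos by (intro mult_left_mono) auto
  with * show ?thesis by (simp add: algebra_simps power2_eq_square)
qed

text \<open>Among the non-neighbours of \<open>u\<close>, choose one with at most one forest
  neighbour in that set. Its degree is at most \<open>(K + 1) + 1 + K\<close>: common neighbours
  with \<open>u\<close>, that forest neighbour, and remaining edges.\<close>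

lemma light_non_neighbour:
  assumes v: "\<And>w. w < n \<Longrightarrow> w \<noteq> u \<Longrightarrow> x w \<le> y" and y: "0 \<le> y"
    and not_dom: "\<exists>w<n. w \<noteq> u \<and> w \<notin> nbrs G u"
  obtains w where "w < n" "w \<noteq> u" "\<rho> * x w \<le> 2 * real (K + 1) * y"
proof -
  let ?W = "{..<n} - nbrs G u - {u}"
  have W: "finite ?W" by simp
  have "?W \<noteq> {}" using not_dom by blast
  then obtain w where w: "w \<in> ?W" "card (NF w \<inter> ?W) \<le> 1"
    by (rule acyclic_low_degree_vertex[OF simple_F F(2) W])
  have uw: "u \<notin> nbrs G w" using w(1) nbrs_sym[of u G w] by blast
  have "nbrs G w \<subseteq> (nbrs G u \<inter> nbrs G w) \<union> (NF w \<inter> ?W) \<union> NB w"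
    using nbrs_split(1)[of w] uw nbrs_lessThan[OF G, of w] by blast
  then have "card (nbrs G w) \<le> card ((nbrs G u \<inter> nbrs G w) \<union> (NF w \<inter> ?W) \<union> NB w)"
    by (rule card_mono[rotated]) (simp add: finite_NB finite_NF finite_nbrs[OF G])
  also have "\<dots> \<le> card (nbrs G u \<inter> nbrs G w) + card (NF w \<inter> ?W) + card (NB w)"
    by (intro order_trans[OF card_Un_le] add_mono card_Un_le order_refl)
  also have "\<dots> \<le> (K + 1) + 1 + K"
    using w codeg[of w] deg_rest[of w] by (intro add_mono) auto
  finally have card: "card (nbrs G w) \<le> 2 * (K + 1)" by simp
  have "\<rho> * x w = sum x (nbrs G w)" using eig[of w] w(1) by simp
  also have "\<dots> \<le> real (card (nbrs G w)) * y"
    using nbrs_lessThan[OF G, of w] uw by (intro sum_bounded_above v) auto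
  also have "\<dots> \<le> real (2 * (K + 1)) * y" using card y by (intro mult_right_mono) auto
  finally show thesis using w(1) by (intro that[of w]) auto
qed

end

text \<open>The numerical core, with \<open>a = K + 1\<close>, \<open>N = n - 1\<close> and
  \<open>r = R\<close>. A cubic lower bound on \<open>\<rho>\<close> suffices because the losses are
  of order \<open>a\<^sup>2 * \<rho>\<close> against \<open>\<rho>\<^sup>2\<close>, and a further
  factor \<open>2 * a\<close> is needed.\<close>

lemma second_entry_small:
  fixes a \<rho> S r N d y :: real
  assumes a: "1 \<le> a" and rho: "(a + 1) ^ 3 - 1 \<le> \<rho>" and N: "N \<le> \<rho>\<^sup>2"
    and S: "(\<rho> - (a - 1)) * S \<le> 2 * N"
    and d: "\<rho>\<^sup>2 \<le> d + a * S + (a - 1) * \<rho>" and r: "r \<le> N - d"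
    and y: "y * (\<rho>\<^sup>2 - (a - 1) * \<rho> - a * r) \<le> \<rho> + a"
  shows "2 * a * y < 1"
proof -
  have cube: "a ^ 3 + 3 * a\<^sup>2 + 3 * a \<le> \<rho>"
    using rho by (simp add: power3_eq_cube power2_eq_square algebra_simps)
  have a2: "a \<le> a\<^sup>2" "1 \<le> a\<^sup>2" "a\<^sup>2 \<le> a ^ 3"
    using a by (simp_all add: self_le_power power_increasing)
  have rho0: "0 < \<rho>" and rho2: "a\<^sup>2 < \<rho>" using cube a a2 by linarith+
  \<comment> \<open>So \<open>a - 1\<close> is at most an eleventh of \<open>\<rho>\<close>, which
    costs only the factor \<open>10 / 11\<close> in the bound on \<open>S\<close>.\<close>
  have "11 * a - 11 \<le> \<rho>"
  proof -
    have "0 \<le> (a - 1)\<^sup>2" by simp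
    then have "2 * a \<le> a\<^sup>2 + 1" by (simp add: power2_eq_square algebra_simps)
    then show ?thesis using cube a2 by linarith
  qed
  then have "S * (10 / 11 * \<rho>) \<le> (\<rho> - (a - 1)) * S" if "0 \<le> S"
    using that by (subst mult.commute) (intro mult_right_mono, auto)
  then have "S * (10 / 11 * \<rho>) \<le> 2 * \<rho>\<^sup>2" if "0 \<le> S" using that S N by linarith
  then have "\<rho> * S \<le> \<rho> * (11 / 5 * \<rho>)" if "0 \<le> S"
    using that by (simp add: power2_eq_square algebra_simps)
  then have S': "S \<le> 11 / 5 * \<rho>" using rho0 by (cases "0 \<le> S") auto
  have "r \<le> a * S + (a - 1) * \<rho>" using r d N by linarith
  also have "\<dots> \<le> a * (11 / 5 * \<rho>) + (a - 1) * \<rho>" using a S' by (intro add_right_mono mult_left_mono) auto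
  finally have "a * r \<le> a * (a * (11 / 5 * \<rho>) + (a - 1) * \<rho>)" using a by (intro mult_left_mono) auto
  \<comment> \<open>The coefficient \<open>16 / 5\<close> is \<open>11 / 5\<close> from the bound on
    \<open>S\<close> plus 1 from the term \<open>(a - 1) * \<rho>\<close>.\<close>
  then have D: "\<rho> * (\<rho> - 16 / 5 * a\<^sup>2 + 1) \<le> \<rho>\<^sup>2 - (a - 1) * \<rho> - a * r"
    by (simp add: power2_eq_square algebra_simps)
  have "2 \<le> \<rho> - 16 / 5 * a\<^sup>2 + 1 - 2 * a" using cube a a2 by linarith
  then have "\<rho> * 2 \<le> \<rho> * (\<rho> - 16 / 5 * a\<^sup>2 + 1 - 2 * a)"
    using rho0 by (intro mult_left_mono) auto
  then have "2 * a * (\<rho> + a) < \<rho> * (\<rho> - 16 / 5 * a\<^sup>2 + 1)"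
    using rho2 by (simp add: power2_eq_square algebra_simps)
  with D have D': "2 * a * (\<rho> + a) < \<rho>\<^sup>2 - (a - 1) * \<rho> - a * r" (is "_ < ?D") by linarith
  have "2 * a * (y * ?D) \<le> 2 * a * (\<rho> + a)" using y a by (intro mult_left_mono) auto
  then have "(2 * a * y) * ?D < 1 * ?D" using D' by (simp add: mult.assoc)
  moreover have "0 < 2 * a * (\<rho> + a)" using a rho0 by simp
  ultimately show ?thesis using D' by (simp add: mult_less_cancel_right)
qed

section \<open>Extremal graphs\<close>

definition star :: "nat \<Rightarrow> nat set set" where
  "star n = (\<lambda>v. {0, v}) ` {1..<n}"

lemma simple_graph_star: "0 < n \<Longrightarrow> simple_graph n (star n)"
  by (auto simp: simple_graph_def star_def)

lemma star_acyclic: "\<not> is_cycle (star n) c"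
proof
  assume c: "is_cycle (star n) c"
  have "v \<notin> set c" if "v \<noteq> 0" for v
    using that by (intro leaf_notin_cycle[OF c, of v 0]) (auto simp: nbrs_def star_def doubleton_eq_iff)
  then have "card (set c) \<le> card {0::nat}" by (intro card_mono) auto
  then show False using c by (simp add: is_cycle_def distinct_card)
qed

lemma G''_family_rho_lower:
  assumes G: "G \<in> G''_family n k" and k: "1 \<le> k" and n: "64 * k ^ 6 \<le> n"
  shows "8 * real k ^ 3 - 1 \<le> spectral_radius_graph n G"
    and "real (n - 1) \<le> (spectral_radius_graph n G)\<^sup>2"
proof -
  have n0: "0 < n" using n k by (cases n) auto
  have "\<not> has_k_edge_disjoint_cycles k (star n)"
    using star_acyclic k by (auto simp: has_k_edge_disjoint_cycles_def intro!: exI[of _ 0])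
  then have le: "spectral_radius_graph n (star n) \<le> spectral_radius_graph n G"
    using G simple_graph_star[OF n0] by (simp add: G''_family_def)
  have dom: "v \<in> nbrs (star n) 0" if "v < n" "v \<noteq> 0" for v
    using that by (auto simp: nbrs_def star_def insert_commute)
  let ?r = "spectral_radius_graph n (star n)"
  have r: "real (n - 1) \<le> ?r\<^sup>2" "0 \<le> ?r"
    by (rule dominating_lower[OF n0 simple_graph_star[OF n0] dom]; assumption)+
  have k1: "1 \<le> real k ^ 3" using k by simp
  have "real (64 * k ^ 6) \<le> real n" using n by (simp only: of_nat_le_iff)
  then have "64 * real k ^ 6 - 1 \<le> ?r\<^sup>2" using r(1) n0 by (simp add: of_nat_diff)
  moreover have "(8 * real k ^ 3 - 1)\<^sup>2 = 64 * real k ^ 6 - 16 * real k ^ 3 + 1"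
    by (simp add: power2_eq_square algebra_simps flip: power_add)
  \<comment> \<open>The unit lost in \<open>n - 1\<close> is absorbed by the cross term, as
    \<open>16 * k ^ 3 \<ge> 2\<close>.\<close>
  ultimately have "(8 * real k ^ 3 - 1)\<^sup>2 \<le> ?r\<^sup>2" using k1 by linarith
  then have "8 * real k ^ 3 - 1 \<le> ?r" using r(2) by (rule power2_le_imp_le)
  with le show "8 * real k ^ 3 - 1 \<le> spectral_radius_graph n G" by linarith
  have "?r\<^sup>2 \<le> (spectral_radius_graph n G)\<^sup>2" using le r(2) by (rule power_mono)
  with r(1) show "real (n - 1) \<le> (spectral_radius_graph n G)\<^sup>2" by linarith
qed

lemma G''_family_dominating:
  assumes G: "G \<in> G''_family n k" and k: "1 \<le> k" and n: "64 * k ^ 6 \<le> n"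
  obtains u where "u < n" "\<And>v. v < n \<Longrightarrow> v \<noteq> u \<Longrightarrow> v \<in> nbrs G u"
proof -
  define \<rho> where "\<rho> = spectral_radius_graph n G"
  have simple: "simple_graph n G" and no_k: "\<not> has_k_edge_disjoint_cycles k G"
    using G by (auto simp: G''_family_def)
  have rho: "8 * real k ^ 3 - 1 \<le> \<rho>" unfolding \<rho>_def by (rule G''_family_rho_lower(1)[OF assms])
  have "1 \<le> real k ^ 3" using k by simp
  then have rho_pos: "0 < \<rho>" using rho by linarith
  have n0: "0 < n" using n k by (cases n) auto
  obtain x u where u: "u < n" "x u = 1" and x: "\<And>i. 0 \<le> x i" "\<And>i. i < n \<Longrightarrow> x i \<le> 1"
    and eig: "\<And>i. i < n \<Longrightarrow> sum x (nbrs G i) = \<rho> * x i"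
    by (rule perron_graph[OF n0 simple, folded \<rho>_def]) (rule that; assumption)
  have ext: "spectral_radius_graph n H \<le> \<rho>"
    if "simple_graph n H" "\<not> has_k_edge_disjoint_cycles k H" for H
    using G that unfolding G''_family_def \<rho>_def by blast
  have "v \<in> nbrs G u" if v: "v < n" "v \<noteq> u" for v
  proof (rule ccontr)
    assume not_nbr: "v \<notin> nbrs G u"
    \<comment> \<open>At most \<open>k - 1\<close> cycles are split off, each of degree at most 2 at
      a vertex. Then \<open>K + 1 = 2 * k - 1\<close> is exactly the bound on codegrees.\<close>
    define K where "K = 2 * (k - 1)"
    have Kk: "K + 1 < 2 * k" "2 * k \<le> K + 2" using k by (auto simp: K_def)
    have "\<not> has_k_edge_disjoint_cycles (Suc (k - 1)) G" using no_k k by simp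
    from cycle_decomposition[OF this] obtain F where F: "F \<subseteq> G" "\<nexists>c. is_cycle F c" and deg: "\<forall>v. card (nbrs (G - F) v) \<le> 2 * (k - 1)"
      by blast
    interpret forest_split n G F K x \<rho> u
    proof
      fix w assume "w \<noteq> u"
      then show "card (nbrs G u \<inter> nbrs G w) \<le> K + 1"
        using codegree_less[OF simple no_k, of u w] Kk(2) by simp
    next
      show "card (nbrs (G - F) v) \<le> K" for v using deg by (simp add: K_def)
    qed (fact simple F x u eig rho_pos)+
    let ?A = "{..<n} - {u}"
    have fin: "finite (x ` ?A)" "x ` ?A \<noteq> {}" using v by auto
    obtain z where z: "z \<in> ?A" "x z = Max (x ` ?A)"
      using Max_in[OF fin] unfolding image_iff by metis
    have max: "x w \<le> x z" if "w < n" "w \<noteq> u" for w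
      using fin that unfolding z(2) by (intro Max_ge) auto
    define a where "a = real (K + 1)"
    have a: "1 \<le> a" "a + 1 = 2 * real k" "a - 1 = real K" using k by (auto simp: a_def K_def of_nat_diff)
    have N: "real (n - 1) \<le> \<rho>\<^sup>2" unfolding \<rho>_def by (rule G''_family_rho_lower(2)[OF assms])
    have "2 * a * x z < 1"
    proof (rule second_entry_small[OF a(1)])
      show "(a + 1) ^ 3 - 1 \<le> \<rho>" unfolding a(2) using rho by (simp add: power_mult_distrib)
      show "(\<rho> - (a - 1)) * (\<Sum>v<n. x v) \<le> 2 * real (n - 1)" unfolding a(3) by (rule sum_entries_le)
      show "\<rho>\<^sup>2 \<le> real (card (nbrs F u)) + a * (\<Sum>v<n. x v) + (a - 1) * \<rho>"
        unfolding a(3) unfolding a_def by (rule rho_square_le)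
      show "x z * (\<rho>\<^sup>2 - (a - 1) * \<rho> - a * real (card {e \<in> F. u \<notin> e})) \<le> \<rho> + a"
        unfolding a(3) unfolding a_def using z(1) max by (intro second_entry_le) auto
    qed (fact N R_le)+
    moreover obtain w where w: "w < n" "w \<noteq> u" "\<rho> * x w \<le> 2 * real (K + 1) * x z"
    proof (rule light_non_neighbour[OF max x(1)[of z]])
      show "\<exists>w<n. w \<noteq> u \<and> w \<notin> nbrs G u" using v not_nbr by blast
    qed
    \<comment> \<open>Extremality of \<open>G\<close> applied to the graph with \<open>w\<close>
      made pendant; this contradicts \<open>\<rho> * x w \<le> 2 * a * x z < 1\<close>.\<close>
    moreover have "1 \<le> \<rho> * x w"
    proof (rule extremal_perron_entry_lower[OF simple u w(1,2) eig rho_pos x(1)])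
      let ?G = "pendant_at G u w"
      have s: "simple_graph n ?G" using simple_graph_pendant_at[OF simple u(1) w(1)] w(2) by simp
      have "spectral_radius_graph n ?G \<le> \<rho>"
        by (rule ext[OF s pendant_at_no_k_cycles[OF no_k]])
      moreover fix y :: "nat \<Rightarrow> real"
      have "quad_form n (adj ?G) y \<le> spectral_radius_graph n ?G * (\<Sum>i<n. (y i)\<^sup>2)"
        by (rule quad_form_le_spectral_radius[OF n0 s])
      moreover have "0 \<le> (\<Sum>i<n. (y i)\<^sup>2)" by (simp add: sum_nonneg)
      ultimately show "quad_form n (adj ?G) y \<le> \<rho> * (\<Sum>i<n. (y i)\<^sup>2)"
        by (meson mult_right_mono order_trans)
    qed
    ultimately show False by (simp add: a_def)
  qed
  then show thesis by (rule that[OF u(1)])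
qed

section \<open>Comparing edge numbers of graphs with a dominating vertex\<close>

lemma max_degree_dominating:
  assumes G: "simple_graph n G" and n: "0 < n"
  shows "max_degree n G = n - 1 \<longleftrightarrow> (\<exists>u<n. \<forall>v<n. v \<noteq> u \<longrightarrow> v \<in> nbrs G u)"
proof -
  have deg: "Defs.degree G v = card (nbrs G v)" for v by (simp add: Defs.degree_def nbrs_def)
  have sub: "nbrs G u \<subseteq> {..<n} - {u}" for u using nbrs_lessThan[OF G] not_self_nbr[OF G] by blast
  have le: "card (nbrs G u) \<le> n - 1" if "u < n" for u
    using card_mono[OF _ sub[of u]] that by simp
  have eq: "card (nbrs G u) = n - 1 \<longleftrightarrow> (\<forall>v<n. v \<noteq> u \<longrightarrow> v \<in> nbrs G u)" if "u < n" for u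
  proof
    assume "card (nbrs G u) = n - 1"
    then have "nbrs G u = {..<n} - {u}" using that by (intro card_subset_eq sub) auto
    then show "\<forall>v<n. v \<noteq> u \<longrightarrow> v \<in> nbrs G u" by blast
  next
    assume "\<forall>v<n. v \<noteq> u \<longrightarrow> v \<in> nbrs G u"
    then have "nbrs G u = {..<n} - {u}" using sub by blast
    then show "card (nbrs G u) = n - 1" using that by simp
  qed
  have "max_degree n G = n - 1 \<longleftrightarrow> n - 1 \<in> Defs.degree G ` {..<n}"
    unfolding max_degree_def using n le by (subst Max_eq_iff) (auto simp: deg)
  also have "\<dots> \<longleftrightarrow> (\<exists>u<n. n - 1 = card (nbrs G u))" by (auto simp: deg image_iff)
  finally show ?thesis using eq by metis
qed

text \<open>Codegrees bound the degrees away from \<open>u\<close> by \<open>2 * k - 1\<close>, so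
  more edges would contain a matching of size \<open>k\<close>, which a dominating vertex
  excludes.\<close>

lemma dominating_card_bound:
  assumes u: "u < n" and G: "simple_graph n G" "\<not> has_k_edge_disjoint_cycles k G" and k: "1 \<le> k"
    and dom: "\<And>v. v < n \<Longrightarrow> v \<noteq> u \<Longrightarrow> v \<in> nbrs G u"
  shows "card {e \<in> G. u \<notin> e} \<le> 2 * (2 * k - 1) * (k - 1)"
proof (rule ccontr)
  let ?H = "{e \<in> G. u \<notin> e}"
  assume "\<not> ?thesis"
  then have big: "2 * (2 * k - 1) * (k - 1) < card ?H" by simp
  have H: "simple_graph n ?H" by (rule simple_graph_subset[OF G(1)]) auto
  have "\<exists>M\<subseteq>?H. card M = Suc (k - 1) \<and> finite M \<and> pairwise disjnt M"
  proof (rule ex_matching[OF _ _ _ big])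
    show "finite ?H" by (rule simple_graph_finite[OF H])
    show "card e = 2" if "e \<in> ?H" for e using H that by (auto simp: simple_graph_def)
    fix v
    show "card {e \<in> ?H. v \<in> e} \<le> 2 * k - 1"
    proof (cases "v = u")
      case True
      then have "{e \<in> ?H. v \<in> e} = {}" by auto
      then show ?thesis by (simp only: card.empty)
    next
      case False
      have "nbrs ?H v \<subseteq> nbrs G u \<inter> nbrs G v"
      proof
        fix z assume z: "z \<in> nbrs ?H v"
        then have "z \<noteq> u" "z < n" "z \<in> nbrs G v" using nbrs_lessThan[OF H] by (auto simp: nbrs_def)
        then show "z \<in> nbrs G u \<inter> nbrs G v" using dom by blast
      qed
      then have "card (nbrs ?H v) \<le> card (nbrs G u \<inter> nbrs G v)"
        by (rule card_mono[rotated]) (simp add: finite_nbrs[OF G(1)])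
      then show ?thesis
        using codegree_less[OF G, of u v] False card_incident_edges[OF H, of v] by simp
    qed
  qed
  then obtain M where "M \<subseteq> ?H" "card M = k" "finite M" "pairwise disjnt M" using k by auto
  then show False using dominating_matching_card[OF G dom] by blast
qed

theorem theorem5p1:
  fixes n k :: nat
  assumes "k \<ge> 1" and "n \<ge> 64 * k ^ 6"
  shows "G''_family n k \<subseteq> G'_family n k"
proof
  fix G assume G: "G \<in> G''_family n k"
  have n0: "0 < n" using assms by (cases n) auto
  define \<rho> where "\<rho> = spectral_radius_graph n G"
  have simple: "simple_graph n G" and no_k: "\<not> has_k_edge_disjoint_cycles k G"
    using G by (auto simp: G''_family_def)
  obtain u where u: "u < n" and dom: "\<And>v. v < n \<Longrightarrow> v \<noteq> u \<Longrightarrow> v \<in> nbrs G u"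
    using G''_family_dominating[OF G assms] by blast
  have rho: "8 * real k ^ 3 - 1 \<le> \<rho>" unfolding \<rho>_def by (rule G''_family_rho_lower(1)[OF G assms])
  define a where "a = 2 * k - 1"
  have ra: "2 * real k = real a + 1" "1 \<le> real a" using assms(1) by (auto simp: a_def of_nat_diff)
  have "8 * real k ^ 3 = (real a + 1) ^ 3" unfolding ra(1)[symmetric] by (simp add: power_mult_distrib)
  then have cube: "real a ^ 3 + 3 * (real a)\<^sup>2 + 3 * real a \<le> \<rho>"
    using rho by (simp add: power3_eq_cube power2_eq_square algebra_simps)
  have "0 \<le> real a ^ 3" "0 \<le> (real a)\<^sup>2" by simp_all
  then have a_lt: "real a < \<rho>" using cube ra(2) by linarith
  define m where "m = card {e \<in> G. u \<notin> e}"
  have "card G = n - 1 + m" unfolding m_def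
  proof -
    obtain x where x: "x u = 1" "\<And>i. i < n \<Longrightarrow> sum x (nbrs G i) = \<rho> * x i"
      using dominating_perron[OF u simple dom] unfolding \<rho>_def by metis
    show "card G = n - 1 + card {e \<in> G. u \<notin> e}" by (rule dominating_identity(3)[OF u simple dom x])
  qed
  moreover have "real m \<le> real a * (real a - 1)"
  proof -
    have "m \<le> a * (2 * (k - 1))"
      using dominating_card_bound[OF u simple no_k assms(1) dom] by (simp add: m_def a_def mult_ac)
    then have "real m \<le> real (a * (2 * (k - 1)))" by (rule of_nat_mono)
    also have "\<dots> = real a * (real a - 1)" using ra(1) assms(1) by (simp add: of_nat_diff)
    finally show ?thesis .
  qed
  ultimately have m: "card G = n - 1 + m" "real m \<le> real a * (real a - 1)" by blast+
  have "card H \<le> card G" if H: "simple_graph n H" "max_degree n H = n - 1" "\<not> has_k_edge_disjoint_cycles k H" for H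
  proof (rule ccontr)
    assume "\<not> card H \<le> card G"
    then have card: "real (card G) + 1 \<le> real (card H)" by simp
    obtain w where w: "w < n" "\<And>v. v < n \<Longrightarrow> v \<noteq> w \<Longrightarrow> v \<in> nbrs H w"
      using H(2) unfolding max_degree_dominating[OF H(1) n0] by blast
    define \<sigma> where "\<sigma> = spectral_radius_graph n H"
    define N where "N = real (n - 1)"
    have \<sigma>: "N \<le> \<sigma>\<^sup>2" "0 \<le> \<sigma>" "2 * (real (card H) - N) \<le> \<sigma> * (\<sigma>\<^sup>2 - N)"
      unfolding N_def \<sigma>_def by (rule dominating_lower[OF w(1) H(1) w(2)]; assumption)+
    have le: "\<sigma> \<le> \<rho>" using G H(1,3) by (simp add: G''_family_def \<sigma>_def \<rho>_def)
    have "\<sigma>\<^sup>2 \<le> \<rho>\<^sup>2" using le \<sigma>(2) by (rule power_mono)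
    \<comment> \<open>Both factors are nonnegative and grow with the spectral radius.\<close>
    then have 1: "\<sigma> * (\<sigma>\<^sup>2 - N) \<le> \<rho> * (\<rho>\<^sup>2 - N)" using le \<sigma> by (intro mult_mono) auto
    have 2: "\<rho> * (\<rho>\<^sup>2 - N) \<le> 2 * (real (card G) - N) * (1 + real a / (\<rho> - real a))"
      unfolding N_def \<rho>_def
    proof (rule dominating_upper[OF u simple dom])
      show "card (nbrs G u \<inter> nbrs G v) \<le> a" if "v \<noteq> u" for v
        using codegree_less[OF simple no_k, of u v] that by (simp add: a_def)
      show "real a < spectral_radius_graph n G" using a_lt unfolding \<rho>_def .
    qed
    have mN: "real (card G) - N = real m" using m(1) by (simp add: N_def)
    then have "real m + 1 \<le> real (card H) - N" using card by linarith
    then have "2 * (real m + 1) \<le> 2 * (real (card H) - N)" by simp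
    also note \<sigma>(3)
    also note 1
    also note 2[unfolded mN]
    finally have "2 * (real m + 1) \<le> 2 * (real m * (1 + real a / (\<rho> - real a)))"
      by (simp only: mult.assoc)
    then have "real m + 1 \<le> real m * (1 + real a / (\<rho> - real a))"
      by (simp only: mult_le_cancel_left_pos zero_less_numeral)
    \<comment> \<open>One extra edge of \<open>H\<close> would have to be made up for by the error
      term \<open>m * a / (\<rho> - a)\<close>. Since \<open>m \<le> a * (a - 1)\<close>, this would
      keep \<open>\<rho>\<close> below its cubic lower bound.\<close>
    then have "1 \<le> real m * real a / (\<rho> - real a)" by (simp add: distrib_left)
    then have "\<rho> - real a \<le> real m * real a" using a_lt by (simp add: field_simps)
    also have "\<dots> \<le> real a * (real a - 1) * real a" using m(2) by (intro mult_right_mono) auto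
    finally have "\<rho> \<le> real a ^ 3 - (real a)\<^sup>2 + real a"
      by (simp add: power3_eq_cube power2_eq_square algebra_simps)
    moreover have "0 \<le> (real a)\<^sup>2" by simp
    ultimately show False using cube ra(2) by linarith
  qed
  moreover have "max_degree n G = n - 1"
    using u dom max_degree_dominating[OF simple n0] by blast
  ultimately show "G \<in> G'_family n k"
    using simple no_k unfolding G'_family_def by blast
qed

end
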